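(* Let $E$ be an infinite-dimensional separable real Hilbert space, $\mathcal E=\{e_j\}_{j\in\mathbb N}$ an orthonormal basis of $E$, and $\{a_k\}_{k\in\mathbb N}$ a sequence of real numbers. Let $\mathbf\Lambda(t)$, $t\in\mathbb R$, be the group of orthogonal operators on $E$ that leaves each subspace $E_k=\mathrm{span}(e_{2k-1},e_{2k})$, $k\in\mathbb N$, invariant and acts on $E_k$ (in the basis $e_{2k-1},e_{2k}$) by the matrix $\begin{pmatrix}\cos(a_kt)&\sin(a_kt)\\-\sin(a_kt)&\cos(a_kt)\end{pmatrix}$. Let $\mathbb H=L_2(E,\mathcal R,\lambda,\mathbb C)$, where $\lambda$ is the shift- and rotation-invariant finitely additive measure described in the context, let $\mathbf U(t)$, $t\in\mathbb R$, be the one-parameter group of unitary operators on $\mathbb H$ given by $\mathbf U(t)u(x)=u(\mathbf\Lambda(t)x)$, and let $\mathcal H_{\mathcal E}=L_2(E,\mathcal R_{\mathcal E},\lambda_{\mathcal E},\mathbb C)\subset\mathbb H$. If $\{a_k\}\in\ell_1$, then the subspace $\mathcal H_{\mathcal E}$ is invariant with respect to the operators $\mathbf U(t)$, $t\in\mathbb R$, and $\mathbf U(t)|_{\mathcal H_{\mathcal E}}$, $t\in\mathbb R$, is a strongly continuous unitary group in the space $\mathcal H_{\mathcal E}$.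
   Context: A ring of sets is a nonempty family closed under finite unions and differences; a measure on a ring is a finitely additive nonnegative function. For an orthonormal basis (ONB) $\mathcal E=\{e_j\}_{j\in\mathbb N}$ of $E$, $\mathcal K_{\mathcal E}$ denotes the collection consisting of $\varnothing$ and of all nonempty sets $\Pi=\{x\in E:\ (x,e_j)\in[a_j,b_j)\ \forall j\in\mathbb N\}$ with $a,b\in\ell_\infty$ and $\sum_{j}\max\{0,\ln(b_j-a_j)\}<\infty$. Put $\lambda_{\mathcal E}(\varnothing)=0$ and $\lambda_{\mathcal E}(\Pi)=\exp\bigl[\sum_{j}\ln(b_j-a_j)\bigr]$ (equal to $0$ if the sum is $-\infty$). It is known that $\lambda_{\mathcal E}$ extends uniquely to a finitely additive shift-invariant measure on the ring $r_{\mathcal E}$ generated by $\mathcal K_{\mathcal E}$. $\mathcal R_{\mathcal E}$ is the ring of all $A\subset E$ such that for every $\epsilon>0$ there are $A_*,A^*\in r_{\mathcal E}$ with $A_*\subset A\subset A^*$ and $\lambda_{\mathcal E}(A^*\setminus A_* )<\epsilon$, and $\lambda_{\mathcal E}(A)=\inf\{\lambda_{\mathcal E}(A^* ):A^*\in r_{\mathcal E},A^*\supset A\}$ for $A\in\mathcal R_{\mathcal E}$. ONB $\mathcal E=\{e_i\}$, $\mathcal F=\{f_j\}$ are equivalent, $\mathcal E\sim\mathcal F$, if $\prod_{j}\bigl(\sum_{i}|(e_i,f_j)|\bigr)<+\infty$; this is an equivalence relation, and equivalent bases have the same $\mathcal R_{\mathcal E}$ and $\lambda_{\mathcal E}$.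 The measure $\lambda$: let $r$ be the ring generated by $\bigcup_{\mathcal E}\mathcal R_{\mathcal E}$ (over all ONB). The paper shows that there is a unique finitely additive measure $\lambda:r\to[0,+\infty)$ such that $\lambda\bigl(A_0\setminus\bigcup_{j=1}^N A_j\bigr)=\lambda_{\mathcal E_0}(A_0)$ whenever $N\ge 0$, $A_j\in\mathcal R_{\mathcal E_j}$ ($j=0,\dots,N$) and $\mathcal E_j\not\sim\mathcal E_0$ for $j\ge1$. $\mathcal R$ is the completion of $r$: all $A\subset E$ such that for every $\epsilon>0$ there are $A_*,A^*\in r$ with $A_*\subset A\subset A^*$ and $\lambda(A^*\setminus A_* )<\epsilon$; $\lambda(A)=\inf\{\lambda(A^* ):A^*\in r,A^*\supset A\}$ for $A\in\mathcal R$. This $\lambda$ extends every $\lambda_{\mathcal E}$ and is invariant under all shifts and all orthogonal transformations of $E$. For a finitely additive measure $\mu$ on a ring $\mathcal A$, $L_2(E,\mathcal A,\mu,\mathbb C)$ is the Hilbert space obtained by completing $\mathrm{span}_{\mathbb C}\{\chi_A:A\in\mathcal A\}$ (modulo functions of zero seminorm) with respect to the inner product with $(\chi_A,\chi_B)=\mu(A\cap B)$. $\mathcal H_{\mathcal E}$ is identified with the closed linear span of $\{\chi_A:A\in\mathcal R_{\mathcal E}\}$ in $\mathbb H$. The operator $\mathbf U(t)$ is the unitary operator on $\mathbb H$ determined by $\mathbf U(t)\chi_A=\chi_{\mathbf\Lambda(t)^{-1}(A)}$, $A\in\mathcal R$. *)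

theory Defs
  imports "HOL-Analysis.Analysis"
begin

section \<open>Orthonormal bases and their equivalence\<close>

text \<open>Bases are indexed from 0. A space that has such a basis is separable and
  infinite-dimensional.\<close>

definition is_ONB :: "(nat \<Rightarrow> 'e::real_inner) \<Rightarrow> bool" where
  "is_ONB e \<longleftrightarrow>
     (\<forall>i j. e i \<bullet> e j = (if i = j then 1 else 0)) \<and> closure (span (range e)) = UNIV"

text \<open>For orthonormal bases every factor of the product is at least 1 (and may be infinite),
  so the partial products increase and the infinite product is their supremum.\<close>

definition equivalent_ONB :: "(nat \<Rightarrow> 'e::real_inner) \<Rightarrow> (nat \<Rightarrow> 'e) \<Rightarrow> bool" where
  "equivalent_ONB e f \<longleftrightarrow>
     (SUP n. \<Prod>j<n. (\<Sum>i. ennreal \<bar>e i \<bullet> f j\<bar>)) < (top :: ennreal)"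


section \<open>Rings of sets, finitely additive measures, completion\<close>

definition generated_ring_of_sets :: "'a set set \<Rightarrow> 'a set set" where
  "generated_ring_of_sets K = ring_of_sets UNIV hull K"

definition fin_add_measure :: "'a set set \<Rightarrow> ('a set \<Rightarrow> real) \<Rightarrow> bool" where
  "fin_add_measure M m \<longleftrightarrow> (\<forall>A\<in>M. 0 \<le> m A) \<and>
     (\<forall>A\<in>M. \<forall>B\<in>M. A \<inter> B = {} \<longrightarrow> m (A \<union> B) = m A + m B)"

definition completed_ring :: "'a set set \<Rightarrow> ('a set \<Rightarrow> real) \<Rightarrow> 'a set set" where
  "completed_ring M m =
     {A. \<forall>\<epsilon>>0. \<exists>B\<in>M. \<exists>C\<in>M. B \<subseteq> A \<and> A \<subseteq> C \<and> m (C - B) < \<epsilon>}"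

definition completed_measure :: "'a set set \<Rightarrow> ('a set \<Rightarrow> real) \<Rightarrow> 'a set \<Rightarrow> real" where
  "completed_measure M m A = (INF C\<in>{C\<in>M. A \<subseteq> C}. m C)"


section \<open>The measures attached to a basis\<close>

definition block :: "(nat \<Rightarrow> 'e::real_inner) \<Rightarrow> (nat \<Rightarrow> real) \<Rightarrow> (nat \<Rightarrow> real) \<Rightarrow> 'e set" where
  "block e a b = {x. \<forall>j. x \<bullet> e j \<in> {a j..<b j}}"

text \<open>The parameters of a nonempty block. If the block is nonempty then \<open>a j < b j\<close> for all
  \<open>j\<close>, so the logarithms are meaningful; moreover the block then determines \<open>a\<close> and \<open>b\<close>.\<close>

definition block_params ::
    "(nat \<Rightarrow> 'e::real_inner) \<Rightarrow> (nat \<Rightarrow> real) \<Rightarrow> (nat \<Rightarrow> real) \<Rightarrow> bool" where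
  "block_params e a b \<longleftrightarrow>
     bounded (range a) \<and> bounded (range b) \<and>
     summable (\<lambda>j. max 0 (ln (b j - a j))) \<and> block e a b \<noteq> {}"

definition blocks :: "(nat \<Rightarrow> 'e::real_inner) \<Rightarrow> 'e set set" where
  "blocks e = insert {} {block e a b | a b. block_params e a b}"

text \<open>Since the positive parts of \<open>ln (b j - a j)\<close> are summable, the series of logarithms
  either converges or diverges to minus infinity.\<close>

definition block_volume :: "(nat \<Rightarrow> real) \<Rightarrow> (nat \<Rightarrow> real) \<Rightarrow> real" where
  "block_volume a b =
     (if summable (\<lambda>j. ln (b j - a j)) then exp (\<Sum>j. ln (b j - a j)) else 0)"

definition block_ring :: "(nat \<Rightarrow> 'e::real_inner) \<Rightarrow> 'e set set" where
  "block_ring e = generated_ring_of_sets (blocks e)"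

text \<open>The defining property of the (unique) shift-invariant measure on \<open>block_ring e\<close> that
  extends the volume of blocks. Values of \<open>m\<close> outside \<open>block_ring e\<close> are irrelevant.\<close>

definition is_block_measure :: "(nat \<Rightarrow> 'e::real_inner) \<Rightarrow> ('e set \<Rightarrow> real) \<Rightarrow> bool" where
  "is_block_measure e m \<longleftrightarrow>
     fin_add_measure (block_ring e) m \<and>
     m {} = 0 \<and> (\<forall>a b. block_params e a b \<longrightarrow> m (block e a b) = block_volume a b) \<and>
     (\<forall>A\<in>block_ring e. \<forall>v. m ((\<lambda>x. x + v) ` A) = m A)"


section \<open>The shift- and rotation-invariant measure\<close>

text \<open>In this section \<open>mu e\<close> is the block measure of the basis \<open>e\<close>.\<close>

definition basis_ring :: "((nat \<Rightarrow> 'e::real_inner) \<Rightarrow> 'e set \<Rightarrow> real) \<Rightarrow> (nat \<Rightarrow> 'e) \<Rightarrow> 'e set set"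
  where "basis_ring mu e = completed_ring (block_ring e) (mu e)"

definition basis_measure ::
    "((nat \<Rightarrow> 'e::real_inner) \<Rightarrow> 'e set \<Rightarrow> real) \<Rightarrow> (nat \<Rightarrow> 'e) \<Rightarrow> 'e set \<Rightarrow> real"
  where "basis_measure mu e = completed_measure (block_ring e) (mu e)"

definition joint_ring :: "((nat \<Rightarrow> 'e::real_inner) \<Rightarrow> 'e set \<Rightarrow> real) \<Rightarrow> 'e set set" where
  "joint_ring mu = generated_ring_of_sets (\<Union>e\<in>{e. is_ONB e}. basis_ring mu e)"

text \<open>The defining property of the (unique) measure on the ring generated by all the rings
  \<open>basis_ring mu e\<close>.\<close>

definition is_joint_measure ::
    "((nat \<Rightarrow> 'e::real_inner) \<Rightarrow> 'e set \<Rightarrow> real) \<Rightarrow> ('e set \<Rightarrow> real) \<Rightarrow> bool" where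
  "is_joint_measure mu lam \<longleftrightarrow>
     fin_add_measure (joint_ring mu) lam \<and>
     (\<forall>e A n f B. is_ONB e \<and> A \<in> basis_ring mu e \<and>
        (\<forall>j<(n::nat). is_ONB (f j) \<and> B j \<in> basis_ring mu (f j) \<and> \<not> equivalent_ONB (f j) e) \<longrightarrow>
        lam (A - (\<Union>j<n. B j)) = basis_measure mu e A)"


section \<open>Complex Hilbert spaces\<close>

class complex_hilbert_space = banach +
  fixes scaleC :: "complex \<Rightarrow> 'a \<Rightarrow> 'a" (infixr \<open>*\<^sub>C\<close> 75)
    and cinner :: "'a \<Rightarrow> 'a \<Rightarrow> complex"
  assumes scaleC_add_right: "c *\<^sub>C (x + y) = c *\<^sub>C x + c *\<^sub>C y"
    and scaleC_add_left: "(c + d) *\<^sub>C x = c *\<^sub>C x + d *\<^sub>C x"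
    and scaleC_scaleC: "c *\<^sub>C d *\<^sub>C x = (c * d) *\<^sub>C x"
    and scaleC_of_real: "complex_of_real r *\<^sub>C x = r *\<^sub>R x"
    and cinner_commute: "cinner x y = cnj (cinner y x)"
    and cinner_add_left: "cinner (x + y) z = cinner x z + cinner y z"
    and cinner_scaleC_left: "cinner (c *\<^sub>C x) y = c * cinner x y"
    and cinner_self: "cinner x x = complex_of_real ((norm x)\<^sup>2)"

definition cspan :: "'h::complex_hilbert_space set \<Rightarrow> 'h set" where
  "cspan S = module.span scaleC S"

text \<open>\<open>chi\<close> realizes the ambient space as the completion of the complex span of the indicator
  functions of sets in \<open>M\<close>, \<open>chi A\<close> being the class of the indicator function of \<open>A\<close>: such a
  realization is unique up to a unique unitary isomorphism. In particular linear relations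
  between indicator functions hold between the vectors \<open>chi A\<close>, because the norm of a linear
  combination of the latter is the seminorm of the corresponding simple function.\<close>

definition is_L2_space ::
    "'a set set \<Rightarrow> ('a set \<Rightarrow> real) \<Rightarrow> ('a set \<Rightarrow> 'h::complex_hilbert_space) \<Rightarrow> bool" where
  "is_L2_space M m chi \<longleftrightarrow>
     (\<forall>A\<in>M. \<forall>B\<in>M. cinner (chi A) (chi B) = complex_of_real (m (A \<inter> B))) \<and>
     closure (cspan (chi ` M)) = UNIV"

definition unitary_on :: "'h::complex_hilbert_space set \<Rightarrow> ('h \<Rightarrow> 'h) \<Rightarrow> bool" where
  "unitary_on S T \<longleftrightarrow>
     (\<forall>x\<in>S. \<forall>y\<in>S. T (x + y) = T x + T y) \<and> (\<forall>c. \<forall>x\<in>S. T (c *\<^sub>C x) = c *\<^sub>C T x) \<and>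
     T ` S = S \<and> (\<forall>x\<in>S. \<forall>y\<in>S. cinner (T x) (T y) = cinner x y)"

definition strongly_continuous_unitary_group_on ::
    "'h::complex_hilbert_space set \<Rightarrow> (real \<Rightarrow> 'h \<Rightarrow> 'h) \<Rightarrow> bool" where
  "strongly_continuous_unitary_group_on S U \<longleftrightarrow>
     (\<forall>t. unitary_on S (U t)) \<and>
     (\<forall>x\<in>S. U 0 x = x) \<and> (\<forall>s t. \<forall>x\<in>S. U (s + t) x = U s (U t x)) \<and>
     (\<forall>x\<in>S. continuous_on UNIV (\<lambda>t. U t x))"


section \<open>The group of rotations\<close>

text \<open>The planes are spanned by \<open>e (2 * k)\<close>, \<open>e (2 * k + 1)\<close>, and the columns of the matrix
  are the images of these two vectors. As the operators are bounded, these values determine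
  them; in particular the group law need not be stated.\<close>

definition is_rotation_group ::
    "(nat \<Rightarrow> 'e::real_inner) \<Rightarrow> (nat \<Rightarrow> real) \<Rightarrow> (real \<Rightarrow> 'e \<Rightarrow> 'e) \<Rightarrow> bool" where
  "is_rotation_group e a L \<longleftrightarrow>
     (\<forall>t. orthogonal_transformation (L t) \<and> surj (L t)) \<and>
     (\<forall>t k. L t (e (2 * k)) =
              cos (a k * t) *\<^sub>R e (2 * k) - sin (a k * t) *\<^sub>R e (2 * k + 1)) \<and>
     (\<forall>t k. L t (e (2 * k + 1)) =
              sin (a k * t) *\<^sub>R e (2 * k) + cos (a k * t) *\<^sub>R e (2 * k + 1))"

end

theory Submission
  imports Defs
begin

text \<open>The vectors \<open>chi A\<close> of blocks \<open>A\<close> of the basis \<open>e\<close> span a dense subspace of the space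
  in question, and \<open>L t -` A\<close> is a block of the basis \<open>f j = L (- t) (e j)\<close>, so it has the same
  measure as \<open>A\<close>. If this measure is 0, then both vectors vanish. Otherwise the sides of \<open>A\<close> are
  bounded below, and moving the \<open>j\<close>-th pair of faces inwards by \<open>d j\<close> changes the volume
  arbitrarily little when \<open>\<Sum>j. d j\<close> is small. As the angles \<open>t * a k\<close> are summable, the
  coordinates of a point with respect to \<open>e\<close> and \<open>f\<close> differ by a summable sequence. Hence

  \<^item> with a fine grid in finitely many coordinates, a finite union of blocks of \<open>e\<close> fits between
    \<open>L t -` A\<close> and a slightly shrunken block of \<open>f\<close>, so \<open>chi (L t -` A)\<close> lies in the closed span;
  \<^item> for small \<open>t\<close>, a slightly shrunken copy of \<open>A\<close> lies in \<open>A \<inter> L t -` A\<close>, so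
    \<open>chi (L t -` A)\<close> is close to \<open>chi A\<close>.\<close>

section \<open>Rings of sets\<close>

lemma ring_of_sets_generated: "ring_of_sets UNIV (generated_ring_of_sets K)"
  unfolding generated_ring_of_sets_def
proof (rule hull_in)
  fix T :: "'a set set set"
  assume "\<forall>M\<in>T. ring_of_sets UNIV M"
  then show "ring_of_sets UNIV (\<Inter>T)"
    by (auto simp: ring_of_sets_iff)
qed

lemma generated_ring_of_sets_superset: "K \<subseteq> generated_ring_of_sets K"
  unfolding generated_ring_of_sets_def by (rule hull_subset)

lemma generated_ring_of_sets_minimal:
  assumes "K \<subseteq> M" "ring_of_sets UNIV M"
  shows "generated_ring_of_sets K \<subseteq> M"
  unfolding generated_ring_of_sets_def using assms by (rule hull_minimal)

text \<open>The difference of two blocks need not be a finite union of blocks, so blocks do not form a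
  semiring. They are only closed under intersections, which calls for an analogue of Dynkin's
  theorem.\<close>

inductive_set dynkin_ring :: "'a set set \<Rightarrow> 'a set set" for K where
  basic: "A \<in> K \<Longrightarrow> A \<in> dynkin_ring K"
| diff: "A \<in> dynkin_ring K \<Longrightarrow> B \<in> dynkin_ring K \<Longrightarrow> B \<subseteq> A \<Longrightarrow> A - B \<in> dynkin_ring K"
| union: "A \<in> dynkin_ring K \<Longrightarrow> B \<in> dynkin_ring K \<Longrightarrow> A \<inter> B = {} \<Longrightarrow> A \<union> B \<in> dynkin_ring K"

text \<open>Intersecting with a fixed set preserves proper differences and disjoint unions, so by
  \<open>step\<close> only generators have to be checked. It is applied twice: first with a
  generator as the fixed set, where \<open>pi\<close> suffices, then with the arbitrary set
  \<open>B\<close>.\<close>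

lemma dynkin_ring_Int:
  assumes pi: "\<And>A B. A \<in> K \<Longrightarrow> B \<in> K \<Longrightarrow> A \<inter> B \<in> K"
    and "A \<in> dynkin_ring K" "B \<in> dynkin_ring K"
  shows "A \<inter> B \<in> dynkin_ring K"
proof -
  have step: "X \<inter> C \<in> dynkin_ring K"
    if X: "X \<in> dynkin_ring K" and C: "\<And>D. D \<in> K \<Longrightarrow> D \<inter> C \<in> dynkin_ring K" for X C
    using X
  proof induction
    case (basic A)
    then show ?case by (rule C)
  next
    case (diff A B)
    have "(A - B) \<inter> C = A \<inter> C - B \<inter> C" by auto
    moreover have "B \<inter> C \<subseteq> A \<inter> C" using diff by auto
    ultimately show ?case using diff.IH by (simp add: dynkin_ring.diff)
  next
    case (union A B)
    have "(A \<union> B) \<inter> C = A \<inter> C \<union> B \<inter> C" by auto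
    moreover have "(A \<inter> C) \<inter> (B \<inter> C) = {}" using union by auto
    ultimately show ?case using union.IH by (simp add: dynkin_ring.union)
  qed
  have "D \<inter> B \<in> dynkin_ring K" if "D \<in> K" for D
  proof -
    have "B \<inter> D \<in> dynkin_ring K"
      by (rule step) (use assms that in \<open>auto intro: dynkin_ring.basic\<close>)
    then show ?thesis by (simp add: Int_commute)
  qed
  then show ?thesis using assms(2) step by blast
qed

text \<open>Closure under intersections turns an arbitrary difference into the proper one
  \<open>A - A \<inter> B\<close>, and then an arbitrary union into the disjoint one
  \<open>A \<union> (B - A)\<close>.\<close>

lemma generated_ring_subset_dynkin_ring:
  assumes pi: "\<And>A B. A \<in> K \<Longrightarrow> B \<in> K \<Longrightarrow> A \<inter> B \<in> K" and "{} \<in> K"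
  shows "generated_ring_of_sets K \<subseteq> dynkin_ring K"
proof (rule generated_ring_of_sets_minimal)
  show "K \<subseteq> dynkin_ring K" by (auto intro: dynkin_ring.basic)
  have diff: "A - B \<in> dynkin_ring K" if "A \<in> dynkin_ring K" "B \<in> dynkin_ring K" for A B
  proof -
    have "A - A \<inter> B \<in> dynkin_ring K"
      by (rule dynkin_ring.diff) (use that dynkin_ring_Int[OF pi] in auto)
    then show ?thesis by (simp add: Diff_Int_distrib2 Diff_Int)
  qed
  have "A \<union> B \<in> dynkin_ring K" if "A \<in> dynkin_ring K" "B \<in> dynkin_ring K" for A B
  proof -
    have "A \<union> (B - A) \<in> dynkin_ring K"
      by (rule dynkin_ring.union) (use that diff in auto)
    then show ?thesis by simp
  qed
  then show "ring_of_sets UNIV (dynkin_ring K)"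
    using diff assms by (auto simp: ring_of_sets_iff intro: dynkin_ring.basic)
qed

text \<open>Only proper differences and disjoint unions have to be treated. These are the operations
  that \<open>chi\<close> turns into differences and sums of vectors.\<close>

lemma generated_ring_of_sets_induct [consumes 1, case_names Int empty basic diff union]:
  assumes A: "A \<in> generated_ring_of_sets K"
    and Int: "\<And>A B. A \<in> K \<Longrightarrow> B \<in> K \<Longrightarrow> A \<inter> B \<in> K"
    and empty: "{} \<in> K"
    and basic: "\<And>A. A \<in> K \<Longrightarrow> P A"
    and diff: "\<And>A B. \<lbrakk>A \<in> generated_ring_of_sets K; B \<in> generated_ring_of_sets K; B \<subseteq> A; P A; P B\<rbrakk>
      \<Longrightarrow> P (A - B)"
    and union: "\<And>A B. \<lbrakk>A \<in> generated_ring_of_sets K; B \<in> generated_ring_of_sets K; A \<inter> B = {}; P A; P B\<rbrakk>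
      \<Longrightarrow> P (A \<union> B)"
  shows "P A"
proof -
  interpret R: ring_of_sets UNIV "generated_ring_of_sets K" by (rule ring_of_sets_generated)
  have "A \<in> dynkin_ring K"
    using generated_ring_subset_dynkin_ring[of K, OF Int empty] A by (rule subsetD)
  then have "A \<in> generated_ring_of_sets K \<and> P A"
  proof induction
    case (basic A)
    then show ?case using assms(4) generated_ring_of_sets_superset by blast
  qed (auto intro: diff union)
  then show ?thesis ..
qed

section \<open>Finitely additive measures and their completions\<close>

lemma fin_add_measure_empty:
  assumes "ring_of_sets UNIV M" "fin_add_measure M m"
  shows "m {} = 0"
proof -
  interpret ring_of_sets UNIV M by fact
  have "m ({} \<union> {}) = m {} + m {}"
    using assms(2) unfolding fin_add_measure_def by (metis Int_empty_left empty_sets)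
  then show ?thesis by simp
qed

lemma fin_add_measure_Diff:
  assumes "ring_of_sets UNIV M" "fin_add_measure M m" "A \<in> M" "B \<in> M" "A \<subseteq> B"
  shows "m (B - A) = m B - m A"
proof -
  interpret ring_of_sets UNIV M by fact
  have "m (A \<union> (B - A)) = m A + m (B - A)"
    using assms unfolding fin_add_measure_def by (meson Diff Diff_disjoint)
  moreover have "A \<union> (B - A) = B" using assms by auto
  ultimately show ?thesis by simp
qed

lemma fin_add_measure_mono:
  assumes "ring_of_sets UNIV M" "fin_add_measure M m" "A \<in> M" "B \<in> M" "A \<subseteq> B"
  shows "m A \<le> m B"
proof -
  interpret ring_of_sets UNIV M by fact
  have "0 \<le> m (B - A)" using assms unfolding fin_add_measure_def by blast
  then show ?thesis using fin_add_measure_Diff[OF assms] by simp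
qed

lemma completed_ring_superset:
  assumes "ring_of_sets UNIV M" "fin_add_measure M m"
  shows "M \<subseteq> completed_ring M m"
proof
  fix A assume "A \<in> M"
  then show "A \<in> completed_ring M m"
    unfolding completed_ring_def using fin_add_measure_empty[OF assms] by force
qed

text \<open>By monotonicity the infimum over all covers is attained at \<open>A\<close>
  itself.\<close>

lemma completed_measure_eq:
  assumes "ring_of_sets UNIV M" "fin_add_measure M m" "A \<in> M"
  shows "completed_measure M m A = m A"
  unfolding completed_measure_def
proof (rule antisym)
  show "(INF C\<in>{C\<in>M. A \<subseteq> C}. m C) \<le> m A"
    by (rule cINF_lower) (use assms in \<open>auto simp: fin_add_measure_def bdd_below_def\<close>)
  show "m A \<le> (INF C\<in>{C\<in>M. A \<subseteq> C}. m C)"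
    by (rule cINF_greatest) (use assms fin_add_measure_mono in blast)+
qed

section \<open>Blocks\<close>

lemma block_nonempty_less:
  assumes "block e a b \<noteq> {}"
  shows "a j < b j"
proof -
  obtain x where "x \<in> block e a b" using assms by blast
  then have "a j \<le> x \<bullet> e j" "x \<bullet> e j < b j" unfolding block_def by auto
  then show ?thesis by linarith
qed

text \<open>Positivity of \<open>u\<close> makes the logarithms comparable. The comparison is asked
  for only eventually, since the grid cells in \<open>block_ring_between\<close> satisfy it only
  beyond finitely many coordinates.\<close>

lemma summable_pos_ln_mono:
  assumes "summable (\<lambda>j. max 0 (ln (v j :: real)))" "\<And>j. 0 < u j" "eventually (\<lambda>j. u j \<le> v j) sequentially"
  shows "summable (\<lambda>j. max 0 (ln (u j)))"
proof (rule summable_comparison_test_ev[OF _ assms(1)])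
  show "eventually (\<lambda>j. norm (max 0 (ln (u j))) \<le> max 0 (ln (v j))) sequentially"
    using assms(3)
  proof eventually_elim
    case (elim j)
    then have "ln (u j) \<le> ln (v j)" using assms(2)[of j] by simp
    then show ?case by auto
  qed
qed

lemma block_Int:
  "block e a b \<inter> block e c d = block e (\<lambda>j. max (a j) (c j)) (\<lambda>j. min (b j) (d j))"
  unfolding block_def by auto

lemma bounded_range_max_min:
  fixes a c :: "'i \<Rightarrow> real"
  assumes "bounded (range a)" "bounded (range c)"
  shows "bounded (range (\<lambda>j. max (a j) (c j)))" "bounded (range (\<lambda>j. min (a j) (c j)))"
proof -
  obtain A C where A: "\<And>j. \<bar>a j\<bar> \<le> A" and C: "\<And>j. \<bar>c j\<bar> \<le> C"
    using assms unfolding bounded_iff by auto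
  have "\<bar>max (a j) (c j)\<bar> \<le> max A C" "\<bar>min (a j) (c j)\<bar> \<le> max A C" for j
    using A[of j] C[of j] by linarith+
  then show "bounded (range (\<lambda>j. max (a j) (c j)))" "bounded (range (\<lambda>j. min (a j) (c j)))"
    unfolding bounded_iff by auto
qed

text \<open>A nonempty intersection has positive sides that are no longer than those of the first
  block; an empty one belongs to \<open>blocks\<close> by definition.\<close>

lemma blocks_Int:
  assumes "A \<in> blocks e" "B \<in> blocks e"
  shows "A \<inter> B \<in> blocks e"
proof (cases "A \<inter> B = {}")
  case False
  then obtain a b c d where A: "A = block e a b" "block_params e a b"
    and B: "B = block e c d" "block_params e c d"
    using assms unfolding blocks_def by auto
  let ?l = "\<lambda>j. max (a j) (c j)" and ?u = "\<lambda>j. min (b j) (d j)"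
  have AB: "A \<inter> B = block e ?l ?u" using A B block_Int by metis
  have "summable (\<lambda>j. max 0 (ln (?u j - ?l j)))"
  proof (rule summable_pos_ln_mono)
    show "summable (\<lambda>j. max 0 (ln (b j - a j)))" using A(2) unfolding block_params_def by blast
    show "0 < ?u j - ?l j" for j
      using block_nonempty_less[of e ?l ?u j] False unfolding AB by linarith
    have "?u j - ?l j \<le> b j - a j" for j by linarith
    then show "eventually (\<lambda>j. ?u j - ?l j \<le> b j - a j) sequentially" by simp
  qed
  then have "block_params e ?l ?u"
    using A(2) B(2) AB False bounded_range_max_min unfolding block_params_def by auto
  then show ?thesis using AB unfolding blocks_def by blast
qed (auto simp: blocks_def)

section \<open>Prescribed coordinates and shrinking of blocks\<close>

lemma is_ONB_inner: "is_ONB f \<Longrightarrow> f i \<bullet> f j = (if i = j then 1 else 0)"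
  unfolding is_ONB_def by blast

lemma is_ONB_norm: "is_ONB f \<Longrightarrow> norm (f j) = 1"
  by (simp add: norm_eq_sqrt_inner is_ONB_inner)

text \<open>The partial sums of \<open>c j *\<^sub>R f j\<close> are Cauchy, because their distances
  are dominated by those of the partial sums of \<open>\<bar>c j\<bar>\<close>. The inner product
  with \<open>f j\<close> is constant along the partial sums with \<open>n > j\<close>.\<close>

lemma is_ONB_series:
  fixes f :: "nat \<Rightarrow> 'e::{real_inner, complete_space}"
  assumes f: "is_ONB f" and c: "summable (\<lambda>j. \<bar>c j\<bar>)"
  obtains y where "\<And>j. y \<bullet> f j = c j"
proof -
  let ?s = "\<lambda>n. \<Sum>j<n. c j *\<^sub>R f j" and ?T = "\<lambda>n. \<Sum>j<n. \<bar>c j\<bar>"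
  have *: "dist (?s m) (?s n) \<le> dist (?T m) (?T n)" if "m \<le> n" for m n
  proof -
    have "?s n - ?s m = (\<Sum>j\<in>{m..<n}. c j *\<^sub>R f j)"
      using that by (simp add: sum_diff_nat_ivl atLeast0LessThan[symmetric])
    then have "dist (?s m) (?s n) = norm (\<Sum>j\<in>{m..<n}. c j *\<^sub>R f j)"
      by (metis dist_commute dist_norm)
    also have "\<dots> \<le> (\<Sum>j\<in>{m..<n}. \<bar>c j\<bar>)"
      by (rule sum_norm_le) (simp add: is_ONB_norm[OF f])
    also have "\<dots> = ?T n - ?T m"
      using that by (simp add: sum_diff_nat_ivl atLeast0LessThan[symmetric])
    finally show ?thesis by (simp add: dist_real_def)
  qed
  have **: "dist (?s m) (?s n) \<le> dist (?T m) (?T n)" for m n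
    using *[of m n] *[of n m] by (cases m n rule: le_cases) (auto simp: dist_commute)
  have "Cauchy ?T" using c by (simp add: convergent_Cauchy summable_iff_convergent)
  then have "Cauchy ?s" unfolding Cauchy_def using ** by (meson order_le_less_trans)
  then obtain y where y: "?s \<longlonglongrightarrow> y" using Cauchy_convergent convergent_def by blast
  have "y \<bullet> f j = c j" for j
  proof (rule LIMSEQ_unique)
    show "(\<lambda>n. ?s n \<bullet> f j) \<longlonglongrightarrow> y \<bullet> f j" by (intro tendsto_intros y)
    have "?s n \<bullet> f j = c j" if "n > j" for n
      using that by (simp add: inner_sum_left is_ONB_inner[OF f] if_distrib sum.delta' cong: if_cong)
    then show "(\<lambda>n. ?s n \<bullet> f j) \<longlonglongrightarrow> c j"
      by (intro tendsto_eventually) (auto simp: eventually_sequentially intro!: exI[of _ "Suc j"])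
  qed
  then show ?thesis by (rule that)
qed

text \<open>The coordinates of a point of the large block are clamped into the small one. Each moves
  by at most \<open>2 * d j\<close>, so the corrections are absolutely summable and are the
  coordinates of a vector.\<close>

lemma block_shrink_nonempty:
  fixes f :: "nat \<Rightarrow> 'e::{real_inner, complete_space}"
  assumes f: "is_ONB f" and ne: "block f a b \<noteq> {}"
    and d: "\<And>j. 0 \<le> d j" "summable d" and less: "\<And>j. 2 * d j < b j - a j"
  shows "block f (\<lambda>j. a j + d j) (\<lambda>j. b j - d j) \<noteq> {}"
proof -
  obtain x where x: "\<And>j. a j \<le> x \<bullet> f j" "\<And>j. x \<bullet> f j < b j"
    using ne unfolding block_def by auto
  \<comment> \<open>The upper bound \<open>b j - 2 * d j\<close> instead of \<open>b j - d j\<close>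
    keeps \<open>y j\<close> off the excluded upper face. Where \<open>d j = 0\<close>, strictness
    comes from \<open>x\<close>.\<close>
  define y where "y j = max (a j + d j) (min (x \<bullet> f j) (b j - 2 * d j))" for j
  have y: "a j + d j \<le> y j" "y j < b j - d j" "\<bar>y j - x \<bullet> f j\<bar> \<le> 2 * d j" for j
    using x[of j] d(1)[of j] less[of j] unfolding y_def by (auto simp: max_def min_def)
  have "summable (\<lambda>j. \<bar>y j - x \<bullet> f j\<bar>)"
    by (rule summable_comparison_test'[of "\<lambda>j. 2 * d j" 0]) (use y d in \<open>auto intro: summable_mult\<close>)
  then obtain z where "\<And>j. z \<bullet> f j = y j - x \<bullet> f j" using is_ONB_series[OF f] by metis
  then have "x + z \<in> block f (\<lambda>j. a j + d j) (\<lambda>j. b j - d j)"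
    using y unfolding block_def by (simp add: inner_add_left)
  then show ?thesis by blast
qed

lemma bounded_range_abs_bound:
  assumes "bounded (range (a :: 'i \<Rightarrow> real))"
  obtains M where "\<And>j. \<bar>a j\<bar> \<le> M"
  using assms unfolding bounded_iff by auto

lemma bounded_range_if_abs_le:
  assumes "\<And>j. \<bar>a j\<bar> \<le> M"
  shows "bounded (range (a :: 'i \<Rightarrow> real))"
  using assms unfolding bounded_iff by auto

lemma summable_nonneg_le_suminf:
  fixes d :: "nat \<Rightarrow> real"
  assumes "summable d" "\<And>j. 0 \<le> d j"
  shows "d j \<le> suminf d"
  using sum_le_suminf[of d "{j}"] assms by simp

text \<open>The terms of the convergent series of logarithms are bounded, so all sides are at least
  some \<kappa> > 0. Each logarithm then drops by at most \<open>4 / \<kappa> * d j\<close>, and the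
  volume is multiplied by at least \<open>1 - 4 / \<kappa> * suminf d\<close>.\<close>

lemma block_volume_shrink:
  fixes f :: "nat \<Rightarrow> 'e::{real_inner, complete_space}"
  assumes f: "is_ONB f" and par: "block_params f a b" and sm: "summable (\<lambda>j. ln (b j - a j))"
    and "0 < \<epsilon>"
  shows "\<exists>\<eta>>0. \<forall>d. (\<forall>j. 0 \<le> d j) \<and> summable d \<and> suminf d < \<eta> \<longrightarrow>
       block_params f (\<lambda>j. a j + d j) (\<lambda>j. b j - d j) \<and>
       block_volume a b - \<epsilon> \<le> block_volume (\<lambda>j. a j + d j) (\<lambda>j. b j - d j)"
proof -
  let ?V = "block_volume a b"
  have V: "?V = exp (\<Sum>j. ln (b j - a j))" using sm unfolding block_volume_def by simp
  have l: "0 < b j - a j" for j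
    using par block_nonempty_less[of f a b j] unfolding block_params_def by simp
  obtain K where K: "\<And>j. \<bar>ln (b j - a j)\<bar> \<le> K"
    using bounded_range_abs_bound[OF summable_imp_bounded[OF sm]] by metis
  define \<kappa> where "\<kappa> = exp (- K)"
  have \<kappa>: "0 < \<kappa>" "\<kappa> \<le> b j - a j" for j
  proof -
    show "0 < \<kappa>" unfolding \<kappa>_def by simp
    have "exp (- K) \<le> exp (ln (b j - a j))" using K[of j] by simp
    then show "\<kappa> \<le> b j - a j" unfolding \<kappa>_def using l[of j] by (simp only: exp_ln)
  qed
  \<comment> \<open>The first bound keeps \<open>2 * d j\<close> below half of each side, where the
    quadratic estimate of \<open>ln (1 - u)\<close> is available; the second limits the relative
    loss of volume to \<open>\<epsilon> / ?V\<close>.\<close>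
  define \<eta> where "\<eta> = min (\<kappa> / 4) (\<epsilon> * \<kappa> / (4 * ?V))"
  have "0 < ?V" unfolding V by simp
  then have "0 < \<eta>" unfolding \<eta>_def using \<kappa>(1) \<open>0 < \<epsilon>\<close> by simp
  moreover have "block_params f (\<lambda>j. a j + d j) (\<lambda>j. b j - d j) \<and>
       ?V - \<epsilon> \<le> block_volume (\<lambda>j. a j + d j) (\<lambda>j. b j - d j)"
    if d: "\<And>j. 0 \<le> d j" "summable d" "suminf d < \<eta>" for d
  proof -
    have dj: "4 * d j \<le> \<kappa>" for j
      using summable_nonneg_le_suminf[OF d(2,1), of j] d(3) unfolding \<eta>_def by simp
    have less: "2 * d j < b j - a j" for j
      using dj[of j] d(1)[of j] \<kappa>(1) \<kappa>(2)[of j] by linarith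
    let ?l = "\<lambda>j. (b j - d j) - (a j + d j)"
    have bd: "bounded (range (\<lambda>j. a j + d j))" "bounded (range (\<lambda>j. b j - d j))"
    proof -
      have "bounded (range a)" "bounded (range b)" using par unfolding block_params_def by auto
      then obtain A B where A: "\<And>j. \<bar>a j\<bar> \<le> A" and B: "\<And>j. \<bar>b j\<bar> \<le> B"
        using bounded_range_abs_bound by metis
      have "\<bar>a j + d j\<bar> \<le> A + \<kappa>" "\<bar>b j - d j\<bar> \<le> B + \<kappa>" for j
        using A[of j] B[of j] dj[of j] d(1)[of j] by linarith+
      then show "bounded (range (\<lambda>j. a j + d j))" "bounded (range (\<lambda>j. b j - d j))"
        by (auto intro: bounded_range_if_abs_le)
    qed
    have "summable (\<lambda>j. max 0 (ln (?l j)))"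
      by (rule summable_pos_ln_mono[of "\<lambda>j. b j - a j"])
        (use par less d(1) in \<open>auto simp: block_params_def algebra_simps\<close>)
    then have par': "block_params f (\<lambda>j. a j + d j) (\<lambda>j. b j - d j)"
      using bd block_shrink_nonempty[OF f _ d(1,2) less] par unfolding block_params_def by simp
    define g where "g j = ln (b j - a j) - ln (?l j)" for j
    have g: "0 \<le> g j" "g j \<le> 4 / \<kappa> * d j" for j
    proof -
      let ?u = "2 * d j / (b j - a j)"
      have u: "0 \<le> ?u" "?u \<le> 1/2"
        using d(1)[of j] l[of j] dj[of j] \<kappa>(2)[of j] by (auto simp: field_simps)
      have "?l j = (b j - a j) * (1 - ?u)" using l[of j] by (simp add: field_simps)
      then have "ln (?l j) = ln (b j - a j) + ln (1 - ?u)" using l[of j] u by (simp add: ln_mult)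
      then have gu: "g j = - ln (1 - ?u)" unfolding g_def by simp
      have "- ?u - 2 * ?u\<^sup>2 \<le> ln (1 - ?u)" by (rule ln_one_minus_pos_lower_bound[OF u])
      moreover have "?u * ?u \<le> ?u * (1 / 2)" by (rule mult_left_mono[OF u(2,1)])
      then have "2 * ?u\<^sup>2 \<le> ?u" unfolding power2_eq_square by argo
      ultimately have "g j \<le> 2 * ?u" using gu by linarith
      also have "\<dots> = 4 * d j / (b j - a j)" by simp
      also have "\<dots> \<le> 4 * d j / \<kappa>"
        by (rule divide_left_mono) (use d(1)[of j] \<kappa> l[of j] in auto)
      also have "\<dots> = 4 / \<kappa> * d j" by simp
      finally show "g j \<le> 4 / \<kappa> * d j" .
      show "0 \<le> g j" unfolding gu using u by simp
    qed
    have sg: "summable g"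
      by (rule summable_comparison_test'[of "\<lambda>j. 4 / \<kappa> * d j" 0]) (use g d in \<open>auto intro: summable_mult\<close>)
    have lneq: "(\<lambda>j. ln (?l j)) = (\<lambda>j. ln (b j - a j) - g j)" unfolding g_def by simp
    have "block_volume (\<lambda>j. a j + d j) (\<lambda>j. b j - d j) = exp (\<Sum>j. ln (b j - a j) - g j)"
      unfolding block_volume_def lneq using summable_diff[OF sm sg] by simp
    also have "\<dots> = exp ((\<Sum>j. ln (b j - a j)) - suminf g)"
      using suminf_diff[OF sm sg] by simp
    also have "\<dots> = ?V * exp (- suminf g)"
      unfolding V by (simp add: exp_diff exp_minus divide_inverse)
    finally have vol: "block_volume (\<lambda>j. a j + d j) (\<lambda>j. b j - d j) = ?V * exp (- suminf g)" .
    have "suminf g \<le> (\<Sum>j. 4 / \<kappa> * d j)"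
      by (rule suminf_le) (use g sg d in \<open>auto intro: summable_mult\<close>)
    also have "\<dots> = 4 / \<kappa> * suminf d" using d(2) by (rule suminf_mult)
    also have "\<dots> \<le> 4 / \<kappa> * (\<epsilon> * \<kappa> / (4 * ?V))"
      by (rule mult_left_mono) (use d(3) \<kappa>(1) in \<open>auto simp: \<eta>_def\<close>)
    also have "\<dots> = \<epsilon> / ?V" using \<kappa>(1) by simp
    finally have "1 - \<epsilon> / ?V \<le> exp (- suminf g)"
      using exp_ge_add_one_self[of "- suminf g"] by linarith
    then have "?V * (1 - \<epsilon> / ?V) \<le> ?V * exp (- suminf g)" using \<open>0 < ?V\<close> by simp
    then have "?V - \<epsilon> \<le> block_volume (\<lambda>j. a j + d j) (\<lambda>j. b j - d j)"
      unfolding vol using \<open>0 < ?V\<close> by (simp add: right_diff_distrib)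
    then show ?thesis using par' by blast
  qed
  ultimately show ?thesis by (intro exI[of _ \<eta>]) simp
qed

section \<open>Comparison of blocks of two nearby bases\<close>

lemma is_ONB_abs_inner_le:
  assumes "is_ONB e"
  shows "\<bar>x \<bullet> e j\<bar> \<le> norm x"
  using Cauchy_Schwarz_ineq2[of x "e j"] is_ONB_norm[OF assms, of j] by simp

text \<open>On bounded points the coordinates for \<open>e\<close> and \<open>f\<close> differ by a
  summable sequence. Beyond finitely many indices the faces can therefore be compared directly; in
  the remaining coordinates, where the difference need not be small, the set is covered by grid
  cells of \<open>e\<close>. Here \<open>near_f\<close> controls the points of the shrunken block,
  \<open>near_e\<close> the points of the cells beyond the grid coordinates, and \<open>le\<close>
  the diameter of a cell in the grid coordinates.\<close>

lemma block_ring_between: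
  fixes e f :: "nat \<Rightarrow> 'e::{real_inner, complete_space}"
  assumes e: "is_ONB e" and f: "is_ONB f"
    and p: "\<And>j n. p j < 2 * n \<longleftrightarrow> j < 2 * (n::nat)"
    and \<phi>: "\<And>j. 0 \<le> \<phi> j" "summable \<phi>"
    and le: "\<And>x j. \<bar>x \<bullet> f j\<bar> \<le> \<bar>x \<bullet> e j\<bar> + \<bar>x \<bullet> e (p j)\<bar>"
    and near_e: "\<And>x j. \<bar>x \<bullet> f j - x \<bullet> e j\<bar> \<le> \<phi> j * (\<bar>x \<bullet> e j\<bar> + \<bar>x \<bullet> e (p j)\<bar>)"
    and near_f: "\<And>x j. \<bar>x \<bullet> f j - x \<bullet> e j\<bar> \<le> \<phi> j * (\<bar>x \<bullet> f j\<bar> + \<bar>x \<bullet> f (p j)\<bar>)"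
    and par: "block_params f a b" and sm: "summable (\<lambda>j. ln (b j - a j))" and "0 < \<epsilon>"
  obtains I a' b' where "I \<in> block_ring e" "block_params f a' b'"
    "block f a' b' \<subseteq> I" "I \<subseteq> block f a b" "block_volume a b - \<epsilon> \<le> block_volume a' b'"
proof -
  obtain A B where A: "\<And>j. \<bar>a j\<bar> \<le> A" and B: "\<And>j. \<bar>b j\<bar> \<le> B"
    using par bounded_range_abs_bound unfolding block_params_def by metis
  define M where "M = max A B + 1"
  have M: "\<bar>a j\<bar> \<le> M" "\<bar>b j\<bar> \<le> M" "0 < M" for j
    using A[of j] B[of j] unfolding M_def by linarith+
  obtain \<eta> where \<eta>: "0 < \<eta> \<and> (\<forall>d. (\<forall>j. 0 \<le> d j) \<and> summable d \<and> suminf d < \<eta> \<longrightarrow>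
       block_params f (\<lambda>j. a j + d j) (\<lambda>j. b j - d j) \<and>
       block_volume a b - \<epsilon> \<le> block_volume (\<lambda>j. a j + d j) (\<lambda>j. b j - d j))"
    using block_volume_shrink[OF f par sm \<open>0 < \<epsilon>\<close>] by (rule exE)
  then have "0 < \<eta>" by blast
  define q where "q j = M * \<phi> j" for j
  have q: "0 \<le> q j" "summable q" for j
    using M(3) \<phi> unfolding q_def by (auto intro: summable_mult)
  then have qb: "q j \<le> suminf q" for j by (intro summable_nonneg_le_suminf)
  \<comment> \<open>The passage from \<open>f\<close> to \<open>e\<close> costs
    \<open>2 * q j\<close>, and so does the passage back.\<close>
  let ?\<psi> = "\<lambda>j. 4 * q j"
  have s\<psi>: "summable ?\<psi>" using q(2) by (rule summable_mult)
  obtain N where N: "\<And>n. N \<le> n \<Longrightarrow> norm (\<Sum>i. ?\<psi> (i + n)) < \<eta> / 2"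
    using suminf_exist_split[OF _ s\<psi>, of "\<eta> / 2"] \<open>0 < \<eta>\<close> by auto
  define m where "m = 2 * N"
  have pm: "p j < m \<longleftrightarrow> j < m" for j unfolding m_def by (rule p)
  have "norm (\<Sum>i. ?\<psi> (i + m)) < \<eta> / 2" by (rule N) (simp add: m_def)
  then have tail: "(\<Sum>i. ?\<psi> (i + m)) < \<eta> / 2" by simp
  \<comment> \<open>The \<open>m\<close> grid coordinates cost \<open>2 * h\<close> each, together
    less than \<open>\<eta> / 2\<close>; the added 1 covers \<open>m = 0\<close>.\<close>
  define h where "h = \<eta> / (4 * (real m + 1))"
  have h: "0 < h" using \<open>0 < \<eta>\<close> unfolding h_def by simp
  have mh: "real m * (2 * h) < \<eta> / 2" using \<open>0 < \<eta>\<close> unfolding h_def by (simp add: field_simps)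
  \<comment> \<open>Grid of mesh \<open>h\<close> in the first \<open>m\<close> coordinates; \<open>p\<close> preserves \<open>{..<m}\<close> because \<open>m\<close> is even.\<close>
  define d where "d j = (if j < m then 2 * h else ?\<psi> j)" for j
  have d0: "0 \<le> d j" for j using h q(1)[of j] unfolding d_def by simp
  have "summable (\<lambda>i. d (i + m))" using s\<psi> unfolding d_def by (simp add: summable_iff_shift)
  then have sd: "summable d" by (simp only: summable_iff_shift)
  have "suminf d = (\<Sum>i. d (i + m)) + (\<Sum>j<m. d j)" by (rule suminf_split_initial_segment[OF sd])
  also have "\<dots> = (\<Sum>i. ?\<psi> (i + m)) + real m * (2 * h)" unfolding d_def by simp
  finally have "suminf d < \<eta>" using tail mh by simp
  with d0 sd \<eta> have shrink: "block_params f (\<lambda>j. a j + d j) (\<lambda>j. b j - d j)"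
    "block_volume a b - \<epsilon> \<le> block_volume (\<lambda>j. a j + d j) (\<lambda>j. b j - d j)"
    by simp_all
  define W where "W = block f (\<lambda>j. a j + d j) (\<lambda>j. b j - d j)"
  have WD: "a j + d j \<le> x \<bullet> f j" "x \<bullet> f j < b j - d j" if "x \<in> W" for x j
    using that unfolding W_def block_def by auto
  have Wf: "\<bar>x \<bullet> f j\<bar> \<le> M" if "x \<in> W" for x j
    using WD[OF that, of j] M(1,2)[of j] d0[of j] by linarith
  have We: "\<bar>x \<bullet> f j - x \<bullet> e j\<bar> \<le> 2 * q j" if "x \<in> W" for x j
  proof -
    have "\<phi> j * (\<bar>x \<bullet> f j\<bar> + \<bar>x \<bullet> f (p j)\<bar>) \<le> \<phi> j * (M + M)"
      by (intro mult_left_mono add_mono Wf that \<phi>)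
    then show ?thesis using near_f[of x j] unfolding q_def by argo
  qed
  \<comment> \<open>Beyond the grid coordinates the faces of a cell lie halfway between those of
    \<open>block f a b\<close> and those of \<open>W\<close>.\<close>
  define lo where "lo c j = (if j < m then h * of_int (c j) else a j + 2 * q j)" for c :: "nat \<Rightarrow> int" and j
  define up where "up c j = (if j < m then h * of_int (c j) + h else b j - 2 * q j)" for c :: "nat \<Rightarrow> int" and j
  \<comment> \<open>The value 0 beyond the first \<open>m\<close> indices leaves only finitely many
    index functions.\<close>
  define ix where "ix x j = (if j < m then \<lfloor>x \<bullet> e j / h\<rfloor> else 0)" for x j
  have x_cell: "lo (ix x) j \<le> x \<bullet> e j" "x \<bullet> e j < up (ix x) j" if "x \<in> W" for x j
  proof -
    have "lo (ix x) j \<le> x \<bullet> e j \<and> x \<bullet> e j < up (ix x) j"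
    proof (cases "j < m")
      case True
      have "of_int \<lfloor>x \<bullet> e j / h\<rfloor> \<le> x \<bullet> e j / h" "x \<bullet> e j / h < of_int \<lfloor>x \<bullet> e j / h\<rfloor> + 1"
        by linarith+
      then have "h * of_int \<lfloor>x \<bullet> e j / h\<rfloor> \<le> h * (x \<bullet> e j / h)"
        "h * (x \<bullet> e j / h) < h * (of_int \<lfloor>x \<bullet> e j / h\<rfloor> + 1)"
        using h by (auto intro: mult_left_mono mult_strict_left_mono simp del: times_divide_eq_right)
      then have "h * of_int \<lfloor>x \<bullet> e j / h\<rfloor> \<le> x \<bullet> e j" "x \<bullet> e j < h * of_int \<lfloor>x \<bullet> e j / h\<rfloor> + h"
        using h by (simp_all add: distrib_left)
      then show ?thesis using True unfolding lo_def up_def ix_def by simp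
    next
      case False
      then have "d j = 4 * q j" "lo (ix x) j = a j + 2 * q j" "up (ix x) j = b j - 2 * q j"
        unfolding lo_def up_def d_def by simp_all
      then show ?thesis using We[OF that, of j] WD[OF that, of j] by linarith
    qed
    then show "lo (ix x) j \<le> x \<bullet> e j" "x \<bullet> e j < up (ix x) j" by auto
  qed
  define cell where "cell c = block e (lo c) (up c)" for c
  have in_cell: "x \<in> cell (ix x)" if "x \<in> W" for x
    using x_cell[OF that] unfolding cell_def block_def by simp
  have cell_sub: "cell (ix x) \<subseteq> block f a b" if x: "x \<in> W" for x
  proof
    fix y assume y: "y \<in> cell (ix x)"
    have yc: "lo (ix x) j \<le> y \<bullet> e j" "y \<bullet> e j < up (ix x) j" for j
      using y unfolding cell_def block_def by auto
    have "a j \<le> y \<bullet> f j \<and> y \<bullet> f j < b j" for j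
    proof (cases "j < m")
      case True
      \<comment> \<open>Two points of one cell differ by at most \<open>h\<close> in the coordinates
        \<open>j\<close> and \<open>p j\<close> for \<open>e\<close>, hence by at most
        \<open>2 * h\<close> in the coordinate \<open>j\<close> for \<open>f\<close>. This is
        exactly the margin \<open>d j\<close>.\<close>
      have *: "\<bar>(y - x) \<bullet> e i\<bar> \<le> h" if "i < m" for i
        using yc[of i] x_cell[OF x, of i] that unfolding lo_def up_def by (simp add: inner_diff_left)
      have "\<bar>(y - x) \<bullet> f j\<bar> \<le> 2 * h"
        using le[of "y - x" j] *[of j] *[of "p j"] True pm[of j] by linarith
      moreover have "d j = 2 * h" using True unfolding d_def by simp
      ultimately show ?thesis using WD[OF x, of j] unfolding inner_diff_left by linarith
    next
      case False
      \<comment> \<open>Since \<open>p j\<close> also lies beyond the grid coordinates, both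
        coordinates of \<open>y\<close> in \<open>near_e\<close> are bounded by
        \<open>M\<close>.\<close>
      have yM: "\<bar>y \<bullet> e i\<bar> \<le> M" if "\<not> i < m" for i
        using yc[of i] M(1,2)[of i] q(1)[of i] that unfolding lo_def up_def by simp
      have "\<phi> j * (\<bar>y \<bullet> e j\<bar> + \<bar>y \<bullet> e (p j)\<bar>) \<le> \<phi> j * (M + M)"
        using False pm[of j] by (intro mult_left_mono add_mono yM \<phi>) auto
      then have "\<bar>y \<bullet> f j - y \<bullet> e j\<bar> \<le> 2 * q j"
        using near_e[of y j] unfolding q_def by argo
      moreover have "lo (ix x) j = a j + 2 * q j" "up (ix x) j = b j - 2 * q j"
        using False unfolding lo_def up_def by simp_all
      ultimately show ?thesis using yc[of j] by linarith
    qed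
    then show "y \<in> block f a b" unfolding block_def by simp
  qed
  have cell_blocks: "cell (ix x) \<in> blocks e" if x: "x \<in> W" for x
  proof -
    have s: "summable (\<lambda>j. max 0 (ln (up (ix x) j - lo (ix x) j)))"
    proof (rule summable_pos_ln_mono)
      show "summable (\<lambda>j. max 0 (ln (b j - a j)))" using par unfolding block_params_def by blast
      show "0 < up (ix x) j - lo (ix x) j" for j using x_cell[OF x, of j] by linarith
      show "eventually (\<lambda>j. up (ix x) j - lo (ix x) j \<le> b j - a j) sequentially"
      proof (rule eventually_sequentiallyI)
        fix j assume "m \<le> j"
        then show "up (ix x) j - lo (ix x) j \<le> b j - a j"
          using q(1)[of j] unfolding lo_def up_def by simp
      qed
    qed
    \<comment> \<open>In a grid coordinate both faces are within \<open>h\<close> of the coordinate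
      of \<open>x\<close>, which is at most \<open>norm x\<close>; elsewhere
      \<open>M + 2 * suminf q\<close> is a bound.\<close>
    define C where "C = norm x + h + M + 2 * suminf q"
    have C: "\<bar>lo (ix x) j\<bar> \<le> C \<and> \<bar>up (ix x) j\<bar> \<le> C" for j
      using x_cell[OF x, of j] M(1,2)[of j] M(3) h is_ONB_abs_inner_le[OF e, of x j] q(1)[of j] qb[of j]
      unfolding C_def lo_def up_def by (cases "j < m") (simp_all only: if_True if_False, linarith+)
    have "bounded (range (lo (ix x)))" "bounded (range (up (ix x)))"
      using C by (auto intro!: bounded_range_if_abs_le)
    then have "block_params e (lo (ix x)) (up (ix x))"
      using s in_cell[OF x] unfolding block_params_def cell_def by blast
    then show ?thesis unfolding blocks_def cell_def by blast
  qed
  \<comment> \<open>The points of \<open>W\<close> have bounded coordinates for \<open>e\<close>, so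
    they meet only finitely many cells.\<close>
  define K where "K = \<lceil>(M + 2 * suminf q) / h\<rceil> + 1"
  have "ix x j \<in> {-K..K}" if x: "x \<in> W" and j: "j < m" for x j
  proof -
    have "\<bar>x \<bullet> e j\<bar> \<le> M + 2 * suminf q"
      using We[OF x, of j] Wf[OF x, of j] qb[of j] by linarith
    then have "\<bar>x \<bullet> e j / h\<bar> \<le> (M + 2 * suminf q) / h" using h by (simp add: divide_right_mono)
    then have "- (K - 1) \<le> x \<bullet> e j / h" "x \<bullet> e j / h \<le> K - 1"
      unfolding K_def by (simp_all, linarith+)
    then have "- K \<le> \<lfloor>x \<bullet> e j / h\<rfloor>" "\<lfloor>x \<bullet> e j / h\<rfloor> \<le> K" by linarith+
    then show ?thesis using j unfolding ix_def by simp
  qed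
  then have "ix ` W \<subseteq> {c. \<forall>j. (j \<in> {..<m} \<longrightarrow> c j \<in> {-K..K}) \<and> (j \<notin> {..<m} \<longrightarrow> c j = 0)}"
    by (auto simp: ix_def)
  then have fin: "finite (ix ` W)"
    by (rule finite_subset) (rule finite_set_of_finite_funs, auto)
  define I where "I = (\<Union>c\<in>ix ` W. cell c)"
  interpret ring_of_sets UNIV "block_ring e"
    unfolding block_ring_def by (rule ring_of_sets_generated)
  have "blocks e \<subseteq> block_ring e" unfolding block_ring_def by (rule generated_ring_of_sets_superset)
  then have "I \<in> block_ring e" unfolding I_def using fin cell_blocks by (intro finite_UN) auto
  moreover have "W \<subseteq> I" "I \<subseteq> block f a b" using in_cell cell_sub unfolding I_def by auto
  ultimately show ?thesis using shrink unfolding W_def by (intro that) auto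
qed

section \<open>Rotations\<close>

lemma bounded_linear_orthogonal_transformation:
  assumes "orthogonal_transformation (T :: 'e::real_inner \<Rightarrow> 'e)"
  shows "bounded_linear T"
  using assms
  by (intro bounded_linear_intro[where K=1])
    (auto simp: orthogonal_transformation_norm orthogonal_transformation_linear linear_add linear_cmul)

lemma bounded_linear_eq_on_ONB:
  fixes S T :: "'e::real_inner \<Rightarrow> 'e"
  assumes e: "is_ONB e" and S: "bounded_linear S" and T: "bounded_linear T"
    and eq: "\<And>j. S (e j) = T (e j)"
  shows "S x = T x"
proof -
  have "span (range e) \<subseteq> {x. S x = T x}"
    using linear_eq_on_span[of S T "range e"] S T eq bounded_linear.linear by auto
  moreover have "closed {x. S x = T x}"
    using S T by (intro closed_Collect_eq linear_continuous_on)
  ultimately have "closure (span (range e)) \<subseteq> {x. S x = T x}" by (rule closure_minimal)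
  then show ?thesis using e unfolding is_ONB_def by auto
qed

text \<open>Density of the span survives because \<open>T\<close> is continuous and
  surjective.\<close>

lemma is_ONB_orthogonal_image:
  fixes T :: "'e::real_inner \<Rightarrow> 'e"
  assumes e: "is_ONB e" and T: "orthogonal_transformation T" "surj T"
  shows "is_ONB (\<lambda>j. T (e j))"
proof -
  have "T (e i) \<bullet> T (e j) = (if i = j then 1 else 0)" for i j
    using T e by (simp add: orthogonal_transformation_def is_ONB_inner)
  moreover have "closure (span (range (\<lambda>j. T (e j)))) = UNIV"
  proof -
    have "range (\<lambda>j. T (e j)) = T ` range e" by auto
    then have "span (range (\<lambda>j. T (e j))) = T ` span (range e)"
      using T(1) by (simp add: linear_span_image orthogonal_transformation_linear)
    moreover have "T ` closure (span (range e)) \<subseteq> closure (T ` span (range e))"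
      by (rule closure_bounded_linear_image_subset[OF bounded_linear_orthogonal_transformation[OF T(1)]])
    ultimately show ?thesis using e T(2) unfolding is_ONB_def by auto
  qed
  ultimately show ?thesis unfolding is_ONB_def by blast
qed

section \<open>The pairing of indices and the summability of the angles\<close>

definition partner :: "nat \<Rightarrow> nat" where
  "partner j = (if even j then j + 1 else j - 1)"

lemma partner_less_iff: "partner j < 2 * n \<longleftrightarrow> j < 2 * n"
proof (cases "even j")
  case True
  then obtain k where "j = 2 * k" by (elim evenE)
  then show ?thesis unfolding partner_def by auto
next
  case False
  then obtain k where "j = 2 * k + 1" by (elim oddE)
  then show ?thesis unfolding partner_def by auto
qed

text \<open>The half-angle formula gives twice a squared sine, of which one factor is bounded by 1.
  The linear bound puts the cosine on a par with the sine in
  \<open>inner_rotated_near\<close>.\<close>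

lemma abs_one_minus_cos_le: "\<bar>1 - cos x\<bar> \<le> \<bar>x::real\<bar>"
proof -
  have "1 - cos x = 2 * (sin (x / 2))\<^sup>2" using cos_double_sin[of "x / 2"] by simp
  then have "\<bar>1 - cos x\<bar> = 2 * (\<bar>sin (x / 2)\<bar> * \<bar>sin (x / 2)\<bar>)"
    by (simp add: power2_eq_square)
  also have "\<dots> \<le> 2 * (\<bar>x / 2\<bar> * 1)"
    by (intro mult_left_mono mult_mono abs_sin_le_one abs_sin_x_le_abs_x) auto
  finally show ?thesis by simp
qed

text \<open>Each angle serves both vectors of its plane, so a partial sum of even length is twice a
  partial sum for \<open>a\<close>.\<close>

lemma summable_abs_div2:
  fixes a :: "nat \<Rightarrow> real"
  assumes "summable (\<lambda>k. \<bar>a k\<bar>)"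
  shows "summable (\<lambda>j. \<bar>a (j div 2)\<bar>)"
proof (rule summableI_nonneg_bounded)
  fix n
  have double: "(\<Sum>j<2 * n. \<bar>a (j div 2)\<bar>) = 2 * (\<Sum>k<n. \<bar>a k\<bar>)" for n
    by (induction n) auto
  have "(\<Sum>j<n. \<bar>a (j div 2)\<bar>) \<le> (\<Sum>j<2 * n. \<bar>a (j div 2)\<bar>)"
    by (rule sum_mono2) auto
  also have "\<dots> \<le> 2 * (\<Sum>k. \<bar>a k\<bar>)"
    unfolding double using assms by (simp add: sum_le_suminf)
  finally show "(\<Sum>j<n. \<bar>a (j div 2)\<bar>) \<le> 2 * (\<Sum>k. \<bar>a k\<bar>)" .
qed simp

section \<open>The rotated basis and its coordinates\<close>

locale rotation_group =
  fixes e :: "nat \<Rightarrow> 'e::{real_inner, complete_space}" and a :: "nat \<Rightarrow> real"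
    and L :: "real \<Rightarrow> 'e \<Rightarrow> 'e"
  assumes e: "is_ONB e" and rotation: "is_rotation_group e a L"
begin

lemma orthogonal: "orthogonal_transformation (L t)" "surj (L t)"
  using rotation unfolding is_rotation_group_def by auto

lemma inner_L: "L t x \<bullet> L t y = x \<bullet> y"
  using orthogonal unfolding orthogonal_transformation_def by blast

text \<open>A uniform formula for both vectors of a plane; parity affects only the sign of the
  sine.\<close>

lemma L_basis:
  "L t (e j) = cos (a (j div 2) * t) *\<^sub>R e j +
     (if even j then - sin (a (j div 2) * t) else sin (a (j div 2) * t)) *\<^sub>R e (partner j)"
proof (cases "even j")
  case True
  then obtain k where "j = 2 * k" by (elim evenE)
  then show ?thesis using rotation unfolding is_rotation_group_def partner_def by simp
next
  case False
  then obtain k where "j = 2 * k + 1" by (elim oddE)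
  then show ?thesis using rotation unfolding is_rotation_group_def partner_def by simp
qed

lemma L_zero: "L 0 x = x"
  by (rule bounded_linear_eq_on_ONB[OF e bounded_linear_orthogonal_transformation[OF orthogonal(1)]
        bounded_linear_ident]) (simp add: L_basis)

text \<open>On basis vectors this is the addition theorem for sine and cosine within one plane;
  bounded linearity carries it over to the whole space.\<close>

lemma L_add: "L (s + t) x = L s (L t x)"
proof (rule bounded_linear_eq_on_ONB[OF e, of "L (s + t)" "\<lambda>x. L s (L t x)"])
  note bl = bounded_linear_orthogonal_transformation[OF orthogonal(1)]
  note lin = bounded_linear.linear[OF bl]
  show "bounded_linear (L (s + t))" by (rule bl)
  show "bounded_linear (\<lambda>x. L s (L t x))" by (rule bounded_linear_compose[OF bl bl])
  fix j
  show "L (s + t) (e j) = L s (L t (e j))"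
  proof (cases "even j")
    case True
    then have "odd (partner j)" "partner j div 2 = j div 2" "partner (partner j) = j"
      unfolding partner_def by auto
    with True show ?thesis
      by (simp add: L_basis linear_add[OF lin] linear_diff[OF lin] linear_cmul[OF lin]
            cos_add sin_add algebra_simps)
  next
    case False
    then have "even (partner j)" "partner j div 2 = j div 2" "partner (partner j) = j"
      unfolding partner_def by (auto elim!: oddE)
    with False show ?thesis
      by (simp add: L_basis linear_add[OF lin] linear_diff[OF lin] linear_cmul[OF lin]
            cos_add sin_add algebra_simps)
  qed
qed

text \<open>The adjoint of \<open>L (- t)\<close> is its inverse \<open>L t\<close>.\<close>

lemma inner_L_minus: "x \<bullet> L (- t) y = L t x \<bullet> y"
  using inner_L[of t x "L (- t) y"] L_add[of t "- t" y] by (simp add: L_zero)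

text \<open>With the minus sign, the coordinates of \<open>x\<close> in this basis are those of
  \<open>L t x\<close> in \<open>e\<close>, so that preimages of blocks under \<open>L t\<close> are
  blocks again.\<close>

definition rotated :: "real \<Rightarrow> nat \<Rightarrow> 'e" where
  "rotated t j = L (- t) (e j)"

lemma is_ONB_rotated: "is_ONB (rotated t)"
  unfolding rotated_def by (rule is_ONB_orthogonal_image[OF e orthogonal])

lemma vimage_block: "L t -` block e b c = block (rotated t) b c"
  unfolding block_def rotated_def by (auto simp: inner_L_minus)

text \<open>The conditions on \<open>b\<close> and \<open>c\<close> alone carry over verbatim; for
  nonemptiness, a point of the block is pulled back along the surjection \<open>L t\<close>.\<close>

lemma block_params_rotated:
  assumes "block_params e b c"
  shows "block_params (rotated t) b c"
proof -
  obtain x where "x \<in> block e b c" using assms unfolding block_params_def by auto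
  moreover obtain y where "x = L t y" using orthogonal(2)[of t] by (rule surjE)
  ultimately have "y \<in> block (rotated t) b c" unfolding vimage_block[symmetric] by simp
  then show ?thesis using assms unfolding block_params_def by auto
qed

lemma inner_rotated_le: "\<bar>x \<bullet> rotated t j\<bar> \<le> \<bar>x \<bullet> e j\<bar> + \<bar>x \<bullet> e (partner j)\<bar>"
proof -
  have *: "\<bar>c * y\<bar> \<le> \<bar>y\<bar>" if "\<bar>c\<bar> \<le> 1" for c y :: real
    using mult_right_mono[OF that, of "\<bar>y\<bar>"] by (simp add: abs_mult)
  show ?thesis
    unfolding rotated_def L_basis inner_add_right inner_scaleR_right
    by (rule order_trans[OF abs_triangle_ineq add_mono]) (rule *, simp)+
qed

text \<open>The coefficients of the difference are \<open>cos ?\<theta> - 1\<close> and, up to sign,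
  \<open>sin ?\<theta>\<close>; both are at most \<open>\<bar>?\<theta>\<bar>\<close> in absolute
  value.\<close>

lemma inner_rotated_near:
  "\<bar>x \<bullet> rotated t j - x \<bullet> e j\<bar>
    \<le> \<bar>t\<bar> * \<bar>a (j div 2)\<bar> * (\<bar>x \<bullet> e j\<bar> + \<bar>x \<bullet> e (partner j)\<bar>)"
proof -
  let ?\<theta> = "a (j div 2) * - t"
  have "x \<bullet> rotated t j - x \<bullet> e j = - (1 - cos ?\<theta>) * (x \<bullet> e j)
      + (if even j then - sin ?\<theta> else sin ?\<theta>) * (x \<bullet> e (partner j))"
    unfolding rotated_def L_basis inner_add_right inner_scaleR_right by (simp add: algebra_simps)
  also have "\<bar>\<dots>\<bar> \<le> \<bar>1 - cos ?\<theta>\<bar> * \<bar>x \<bullet> e j\<bar> + \<bar>sin ?\<theta>\<bar> * \<bar>x \<bullet> e (partner j)\<bar>"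
    by (rule order_trans[OF abs_triangle_ineq]) (simp add: abs_mult)
  also have "\<dots> \<le> \<bar>?\<theta>\<bar> * \<bar>x \<bullet> e j\<bar> + \<bar>?\<theta>\<bar> * \<bar>x \<bullet> e (partner j)\<bar>"
    by (intro add_mono mult_right_mono abs_one_minus_cos_le abs_sin_x_le_abs_x) auto
  also have "\<dots> = \<bar>t\<bar> * \<bar>a (j div 2)\<bar> * (\<bar>x \<bullet> e j\<bar> + \<bar>x \<bullet> e (partner j)\<bar>)"
    by (simp add: abs_mult algebra_simps)
  finally show ?thesis .
qed

text \<open>The same estimate with the roles of the two bases exchanged: rotate back by \<open>L t\<close>.\<close>

lemma inner_rotated_near':
  "\<bar>x \<bullet> rotated t j - x \<bullet> e j\<bar>
    \<le> \<bar>t\<bar> * \<bar>a (j div 2)\<bar> * (\<bar>x \<bullet> rotated t j\<bar> + \<bar>x \<bullet> rotated t (partner j)\<bar>)"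
proof -
  have "x \<bullet> e i = L t x \<bullet> rotated (- t) i" for i
    unfolding rotated_def by (simp add: inner_L)
  moreover have "x \<bullet> rotated t i = L t x \<bullet> e i" for i
    unfolding rotated_def by (rule inner_L_minus)
  ultimately show ?thesis
    using inner_rotated_near[of "L t x" "- t" j] by (simp add: abs_minus_commute)
qed

end

section \<open>Complex Hilbert spaces\<close>

lemma scaleC_one: "1 *\<^sub>C x = (x :: 'h::complex_hilbert_space)"
  using scaleC_of_real[of 1 x] by simp

lemma module_scaleC: "module (scaleC :: complex \<Rightarrow> 'h::complex_hilbert_space \<Rightarrow> 'h)"
  by unfold_locales (simp_all add: scaleC_add_right scaleC_add_left scaleC_scaleC scaleC_one)

lemma cinner_add_right: "cinner x (y + z) = cinner x y + cinner (x :: 'h::complex_hilbert_space) z"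
  by (metis cinner_commute cinner_add_left complex_cnj_add)

lemma cinner_scaleC_right: "cinner x (c *\<^sub>C y) = cnj c * cinner (x :: 'h::complex_hilbert_space) y"
  by (metis cinner_commute cinner_scaleC_left complex_cnj_mult)

lemma cinner_diff_left: "cinner (x - y) z = cinner x z - cinner y (z :: 'h::complex_hilbert_space)"
  using cinner_add_left[of "x - y" y z] by simp

lemma cinner_diff_right: "cinner x (y - z) = cinner x y - cinner (x :: 'h::complex_hilbert_space) z"
  using cinner_add_right[of x "y - z" z] by simp

lemma norm_eq_Re_cinner: "(norm x)\<^sup>2 = Re (cinner x (x :: 'h::complex_hilbert_space))"
  by (simp add: cinner_self)

lemma norm_scaleC: "norm (c *\<^sub>C x) = cmod c * norm (x :: 'h::complex_hilbert_space)"
proof -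
  have "complex_of_real ((norm (c *\<^sub>C x))\<^sup>2) = c * cnj c * complex_of_real ((norm x)\<^sup>2)"
    unfolding cinner_self[symmetric] by (simp add: cinner_scaleC_left cinner_scaleC_right)
  also have "\<dots> = complex_of_real ((cmod c * norm x)\<^sup>2)"
    by (simp add: complex_norm_square[symmetric] power_mult_distrib)
  finally have "(norm (c *\<^sub>C x))\<^sup>2 = (cmod c * norm x)\<^sup>2" by (simp only: of_real_eq_iff)
  then show ?thesis by (rule power2_eq_imp_eq) simp_all
qed

lemma continuous_on_scaleC: "continuous_on S ((*\<^sub>C) c :: 'h::complex_hilbert_space \<Rightarrow> 'h)"
proof -
  have "bounded_linear ((*\<^sub>C) c :: 'h \<Rightarrow> 'h)"
    by (rule bounded_linear_intro[where K="cmod c"])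
      (simp_all add: scaleC_add_right norm_scaleC scaleC_of_real[symmetric] scaleC_scaleC mult.commute)
  then show ?thesis by (rule linear_continuous_on)
qed

lemma cspan_superset: "S \<subseteq> cspan S"
  unfolding cspan_def by (rule module.span_superset[OF module_scaleC])

lemma cspan_add: "x \<in> cspan S \<Longrightarrow> y \<in> cspan S \<Longrightarrow> x + y \<in> cspan S"
  unfolding cspan_def by (rule module.span_add[OF module_scaleC])

lemma cspan_diff: "x \<in> cspan S \<Longrightarrow> y \<in> cspan S \<Longrightarrow> x - y \<in> cspan S"
  unfolding cspan_def by (rule module.span_diff[OF module_scaleC])

lemma closure_cspan_superset: "S \<subseteq> closure (cspan S)"
  using cspan_superset closure_subset by (rule subset_trans)

lemma closure_cspan_0: "0 \<in> closure (cspan S)"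
  using module.span_zero[OF module_scaleC] closure_subset unfolding cspan_def by blast

lemma closure_cspan_add:
  assumes "x \<in> closure (cspan S)" "y \<in> closure (cspan S)"
  shows "x + y \<in> closure (cspan S)"
proof -
  obtain u v where "\<And>n. u n \<in> cspan S" "u \<longlonglongrightarrow> x" "\<And>n. v n \<in> cspan S" "v \<longlonglongrightarrow> y"
    using assms unfolding closure_sequential by blast
  then show ?thesis unfolding closure_sequential
    by (intro exI[of _ "\<lambda>n. u n + v n"]) (simp add: cspan_add tendsto_add)
qed

lemma closure_cspan_scaleC:
  assumes "x \<in> closure (cspan S)"
  shows "c *\<^sub>C x \<in> closure (cspan S)"
proof -
  have "(*\<^sub>C) c ` closure (cspan S) \<subseteq> closure (cspan S)"
  proof (rule image_closure_subset[OF continuous_on_scaleC closed_closure])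
    show "(*\<^sub>C) c ` cspan S \<subseteq> closure (cspan S)"
      using module.span_scale[OF module_scaleC] closure_subset unfolding cspan_def by blast
  qed
  then show ?thesis using assms by blast
qed

text \<open>The vectors with property \<open>P\<close> form a closed complex subspace that contains
  \<open>S\<close>.\<close>

lemma closure_cspan_induct [consumes 1, case_names base zero add scaleC closed]:
  assumes "x \<in> closure (cspan S)"
    and "\<And>x. x \<in> S \<Longrightarrow> P x" and "P 0"
    and "\<And>x y. P x \<Longrightarrow> P y \<Longrightarrow> P (x + y)"
    and "\<And>c x. P x \<Longrightarrow> P (c *\<^sub>C x)"
    and "closed {x. P x}"
  shows "P x"
proof -
  have "cspan S \<subseteq> {x. P x}"
    unfolding cspan_def
    by (rule module.span_minimal[OF module_scaleC])
      (use assms in \<open>auto simp: module.subspace_def[OF module_scaleC]\<close>)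
  then have "closure (cspan S) \<subseteq> {x. P x}" using assms(6) by (rule closure_minimal)
  then show ?thesis using assms(1) by auto
qed

lemma closure_cspan_minimal:
  assumes "S \<subseteq> closure (cspan T)"
  shows "closure (cspan S) \<subseteq> closure (cspan T)"
proof
  fix x assume "x \<in> closure (cspan S)"
  then show "x \<in> closure (cspan T)"
    by (induction rule: closure_cspan_induct)
      (use assms in \<open>auto intro: closure_cspan_0 closure_cspan_add closure_cspan_scaleC\<close>)
qed

section \<open>Unitary groups on the closed span of a set\<close>

lemma unitary_on_UNIV_dist:
  assumes "unitary_on UNIV (T :: 'h::complex_hilbert_space \<Rightarrow> 'h)"
  shows "dist (T x) (T y) = dist x y"
proof -
  have add: "T (u + v) = T u + T v" and inner: "cinner (T u) (T v) = cinner u v" for u v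
    using assms unfolding unitary_on_def by auto
  have "T x = T (x - y) + T y" using add[of "x - y" y] by simp
  then have "T x - T y = T (x - y)" by simp
  moreover have "(norm (T (x - y)))\<^sup>2 = (norm (x - y))\<^sup>2"
    unfolding norm_eq_Re_cinner inner ..
  then have "norm (T (x - y)) = norm (x - y)" by (rule power2_eq_imp_eq) simp_all
  ultimately show ?thesis by (simp add: dist_norm)
qed

lemma continuous_on_unitary:
  assumes "unitary_on UNIV (T :: 'h::complex_hilbert_space \<Rightarrow> 'h)"
  shows "continuous_on S T"
  unfolding continuous_on_iff unitary_on_UNIV_dist[OF assms] by auto

text \<open>All properties are extended from the generators to their closed span by induction.
  Continuity is needed at time 0 only, since the group law transports it to any other time;
  surjectivity on \<open>H\<close> comes from the inverse \<open>U (- t)\<close>.\<close>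

lemma strongly_continuous_unitary_group_closure_cspan:
  fixes U :: "real \<Rightarrow> 'h::complex_hilbert_space \<Rightarrow> 'h"
  assumes U: "\<And>t. unitary_on UNIV (U t)"
    and inv: "\<And>t x. x \<in> S \<Longrightarrow> U t x \<in> closure (cspan S)"
    and zero: "\<And>x. x \<in> S \<Longrightarrow> U 0 x = x"
    and add: "\<And>s t x. x \<in> S \<Longrightarrow> U (s + t) x = U s (U t x)"
    and cont: "\<And>x. x \<in> S \<Longrightarrow> ((\<lambda>t. U t x) \<longlongrightarrow> x) (at 0)"
  defines "H \<equiv> closure (cspan S)"
  shows "(\<forall>t. U t ` H \<subseteq> H) \<and> strongly_continuous_unitary_group_on H U"
proof -
  have U_add: "U t (x + y) = U t x + U t y" and U_scale: "U t (c *\<^sub>C x) = c *\<^sub>C U t x" for t x y c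
    using U unfolding unitary_on_def by auto
  have U_0: "U t 0 = 0" for t using U_add[of t 0 0] by simp
  have cU: "continuous_on UNIV (U t)" for t by (rule continuous_on_unitary[OF U])
  have H_inv: "U t x \<in> H" if "x \<in> H" for t x
    using that unfolding H_def
  proof (induction rule: closure_cspan_induct)
    case closed
    have "closed (U t -` closure (cspan S))"
      by (rule closed_vimage[OF closed_closure cU])
    then show ?case by (simp add: vimage_def)
  qed (auto simp: U_0 U_add U_scale inv closure_cspan_0 closure_cspan_add closure_cspan_scaleC)
  have H_zero: "U 0 x = x" if "x \<in> H" for x
    using that unfolding H_def
  proof (induction rule: closure_cspan_induct)
    case closed
    show ?case by (intro closed_Collect_eq cU continuous_on_id)
  qed (auto simp: U_0 U_add U_scale zero)
  have H_add: "U (s + t) x = U s (U t x)" if "x \<in> H" for s t x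
    using that unfolding H_def
  proof (induction rule: closure_cspan_induct)
    case closed
    show ?case
      by (intro closed_Collect_eq cU continuous_on_compose2[OF cU cU]) auto
  qed (auto simp: U_0 U_add U_scale add)
  have H_cont0: "((\<lambda>t. U t x) \<longlongrightarrow> x) (at 0)" if "x \<in> H" for x
    using that unfolding H_def
  proof (induction rule: closure_cspan_induct)
    case (base x)
    then show ?case by (rule cont)
  next
    case (add x y)
    then show ?case unfolding U_add by (rule tendsto_add)
  next
    case (scaleC c x)
    have "continuous_on UNIV ((*\<^sub>C) c :: 'h \<Rightarrow> 'h)" by (rule continuous_on_scaleC)
    then have "isCont ((*\<^sub>C) c) x" by (simp add: continuous_on_eq_continuous_at)
    then show ?case unfolding U_scale using scaleC by (rule isCont_tendsto_compose)
  next
    case closed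
    \<comment> \<open>All \<open>U t\<close> are isometries, so approximating \<open>x\<close> by
      \<open>y\<close> costs the same for every \<open>t\<close>, and an \<epsilon>/3 argument
      applies.\<close>
    let ?X = "{x. ((\<lambda>t. U t x) \<longlongrightarrow> x) (at 0)}"
    have "x \<in> ?X" if x: "x \<in> closure ?X" for x
      unfolding mem_Collect_eq
    proof (rule tendstoI)
      fix \<epsilon> :: real assume "0 < \<epsilon>"
      then obtain y where y: "((\<lambda>t. U t y) \<longlongrightarrow> y) (at 0)" "dist y x < \<epsilon> / 3"
        using x unfolding closure_approachable by (metis divide_pos_pos mem_Collect_eq zero_less_numeral)
      have "eventually (\<lambda>t. dist (U t y) y < \<epsilon> / 3) (at 0)"
        using y(1) \<open>0 < \<epsilon>\<close> by (intro tendstoD) auto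
      then show "eventually (\<lambda>t. dist (U t x) x < \<epsilon>) (at 0)"
      proof eventually_elim
        case (elim t)
        have "dist (U t x) (U t y) < \<epsilon> / 3"
          unfolding unitary_on_UNIV_dist[OF U] using y(2) by (simp add: dist_commute)
        then show ?case
          using elim y(2) dist_triangle[of "U t x" x "U t y"] dist_triangle[of "U t y" x y] by linarith
      qed
    qed
    then have "closure ?X \<subseteq> ?X" by (rule subsetI)
    then show ?case by (simp only: closure_subset_eq)
  qed (simp add: U_0)
  have "isCont (\<lambda>t. U t x) s" if x: "x \<in> H" for x s
  proof -
    have "((\<lambda>t. U s (U t x)) \<longlongrightarrow> U s x) (at 0)"
      using cU[of s] H_cont0[OF x]
      by (intro isCont_tendsto_compose[of x "U s"]) (simp_all add: continuous_on_eq_continuous_at)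
    then show ?thesis unfolding isCont_iff H_add[OF x] .
  qed
  then have H_cont: "continuous_on UNIV (\<lambda>t. U t x)" if "x \<in> H" for x
    using that by (simp add: continuous_on_eq_continuous_at)
  have "U t ` H = H" for t
  proof
    show "U t ` H \<subseteq> H" using H_inv by blast
    show "H \<subseteq> U t ` H"
    proof
      fix x assume x: "x \<in> H"
      then have "x = U t (U (- t) x)" using H_add[of x t "- t"] H_zero by simp
      then show "x \<in> U t ` H" using H_inv[OF x] by blast
    qed
  qed
  then have "unitary_on H (U t)" for t
    using U[of t] unfolding unitary_on_def by simp
  then have "strongly_continuous_unitary_group_on H U"
    unfolding strongly_continuous_unitary_group_on_def by (simp add: H_zero H_add H_cont)
  then show ?thesis using H_inv by blast
qed

section \<open>Indicator functions\<close>

locale joint_L2 =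
  fixes mu :: "(nat \<Rightarrow> 'e::{real_inner, complete_space}) \<Rightarrow> 'e set \<Rightarrow> real"
    and lam :: "'e set \<Rightarrow> real"
    and chi :: "'e set \<Rightarrow> 'h::complex_hilbert_space"
  assumes block_measure: "\<And>f. is_ONB f \<Longrightarrow> is_block_measure f (mu f)"
    and joint_measure: "is_joint_measure mu lam"
    and L2_space: "is_L2_space (completed_ring (joint_ring mu) lam)
      (completed_measure (joint_ring mu) lam) chi"
begin

section \<open>The joint measure on the rings of the single bases\<close>

lemma ring_block_ring: "ring_of_sets UNIV (block_ring f)"
  unfolding block_ring_def by (rule ring_of_sets_generated)

lemma ring_joint_ring: "ring_of_sets UNIV (joint_ring mu)"
  unfolding joint_ring_def by (rule ring_of_sets_generated)

lemma joint_ring_closed: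
  assumes "A \<in> joint_ring mu" "B \<in> joint_ring mu"
  shows "A \<inter> B \<in> joint_ring mu" "A \<union> B \<in> joint_ring mu" "A - B \<in> joint_ring mu"
proof -
  interpret ring_of_sets UNIV "joint_ring mu" by (rule ring_joint_ring)
  show "A \<inter> B \<in> joint_ring mu" "A \<union> B \<in> joint_ring mu" "A - B \<in> joint_ring mu"
    using assms by (rule Int Un Diff)+
qed

lemma fin_add_mu: "is_ONB f \<Longrightarrow> fin_add_measure (block_ring f) (mu f)"
  by (rule block_measure[unfolded is_block_measure_def, THEN conjunct1])

lemma fin_add_lam: "fin_add_measure (joint_ring mu) lam"
  by (rule joint_measure[unfolded is_joint_measure_def, THEN conjunct1])

lemma block_ring_subset_basis_ring: "is_ONB f \<Longrightarrow> block_ring f \<subseteq> basis_ring mu f"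
  unfolding basis_ring_def by (rule completed_ring_superset[OF ring_block_ring fin_add_mu])

lemma basis_ring_subset_joint_ring: "is_ONB f \<Longrightarrow> basis_ring mu f \<subseteq> joint_ring mu"
  using generated_ring_of_sets_superset[of "\<Union>e\<in>{e. is_ONB e}. basis_ring mu e"]
  unfolding joint_ring_def by auto

lemma block_ring_joint_ring: "is_ONB f \<Longrightarrow> A \<in> block_ring f \<Longrightarrow> A \<in> joint_ring mu"
  by (rule subsetD[OF subset_trans[OF block_ring_subset_basis_ring basis_ring_subset_joint_ring]])

lemma joint_ring_subset_completed: "joint_ring mu \<subseteq> completed_ring (joint_ring mu) lam"
  by (rule completed_ring_superset[OF ring_joint_ring fin_add_lam])

text \<open>The defining property of \<open>lam\<close> is used with \<open>n = 0\<close>, so no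
  sets are subtracted and the families \<open>f\<close> and \<open>B\<close> there are dummies. On
  the block ring the completed measure agrees with \<open>mu f\<close>.\<close>

lemma lam_block_ring:
  assumes "is_ONB f" "A \<in> block_ring f"
  shows "lam A = mu f A"
proof -
  have "A \<in> basis_ring mu f" using assms(2) by (rule subsetD[OF block_ring_subset_basis_ring[OF assms(1)]])
  then have "lam A = basis_measure mu f A"
    using joint_measure[unfolded is_joint_measure_def, THEN conjunct2, rule_format,
        of f A 0 "\<lambda>_. f" "\<lambda>_. {}"] assms(1) by simp
  then show ?thesis
    unfolding basis_measure_def using completed_measure_eq[OF ring_block_ring fin_add_mu] assms by simp
qed

lemma block_block_ring: "block_params f a b \<Longrightarrow> block f a b \<in> block_ring f"
  unfolding block_ring_def
  by (rule subsetD[OF generated_ring_of_sets_superset]) (auto simp: blocks_def)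

lemma block_joint_ring: "is_ONB f \<Longrightarrow> block_params f a b \<Longrightarrow> block f a b \<in> joint_ring mu"
  by (rule block_ring_joint_ring[OF _ block_block_ring])

lemma lam_block: "is_ONB f \<Longrightarrow> block_params f a b \<Longrightarrow> lam (block f a b) = block_volume a b"
  using block_measure[of f] by (simp add: lam_block_ring block_block_ring is_block_measure_def)

section \<open>Linear relations and distances between indicator vectors\<close>

lemma cinner_chi:
  assumes "A \<in> joint_ring mu" "B \<in> joint_ring mu"
  shows "cinner (chi A) (chi B) = complex_of_real (lam (A \<inter> B))"
proof -
  have "cinner (chi A) (chi B) = complex_of_real (completed_measure (joint_ring mu) lam (A \<inter> B))"
    using L2_space[unfolded is_L2_space_def] assms[THEN subsetD[OF joint_ring_subset_completed]]
    by simp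
  then show ?thesis
    by (simp only: completed_measure_eq[OF ring_joint_ring fin_add_lam joint_ring_closed(1)[OF assms]])
qed

text \<open>By additivity of \<open>lam\<close>, the vector \<open>?v\<close> is orthogonal to every
  \<open>chi C\<close>. Being a combination of such vectors, it is orthogonal to itself.\<close>

lemma chi_Un:
  assumes "A \<in> joint_ring mu" "B \<in> joint_ring mu" "A \<inter> B = {}"
  shows "chi (A \<union> B) = chi A + chi B"
proof -
  let ?v = "chi (A \<union> B) - chi A - chi B"
  have AB: "A \<union> B \<in> joint_ring mu" using assms(1,2) by (rule joint_ring_closed)
  have orth: "cinner (chi C) ?v = 0" if C: "C \<in> joint_ring mu" for C
  proof -
    have "lam (C \<inter> A \<union> C \<inter> B) = lam (C \<inter> A) + lam (C \<inter> B)"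
      using assms(3) fin_add_lam[unfolded fin_add_measure_def, THEN conjunct2, rule_format,
        OF joint_ring_closed(1)[OF C assms(1)] joint_ring_closed(1)[OF C assms(2)]] by auto
    then show ?thesis
      by (simp add: cinner_diff_right cinner_chi[OF C] assms(1,2) AB Int_Un_distrib)
  qed
  have "cinner ?v ?v = 0"
    unfolding cinner_diff_left[of _ _ ?v] by (simp add: orth assms(1,2) AB)
  then have "?v = 0" using norm_eq_Re_cinner[of ?v] by simp
  then show ?thesis by (simp add: algebra_simps)
qed

lemma chi_Diff:
  assumes "A \<in> joint_ring mu" "B \<in> joint_ring mu" "B \<subseteq> A"
  shows "chi (A - B) = chi A - chi B"
proof -
  have "chi ((A - B) \<union> B) = chi (A - B) + chi B" using joint_ring_closed(3)[OF assms(1,2)] assms(2)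
    by (rule chi_Un) auto
  moreover have "(A - B) \<union> B = A" using assms by auto
  ultimately show ?thesis by simp
qed

text \<open>The squared distance is the measure of the symmetric difference, and \<open>W\<close>
  bounds the intersection from below. For nested sets, \<open>W\<close> is taken to be the smaller
  one.\<close>

lemma norm_chi_diff_le:
  assumes "A \<in> joint_ring mu" "B \<in> joint_ring mu" "W \<in> joint_ring mu" "W \<subseteq> A \<inter> B"
  shows "(norm (chi A - chi B))\<^sup>2 \<le> (lam A - lam W) + (lam B - lam W)"
proof -
  have "lam W \<le> lam (A \<inter> B)"
    using assms joint_ring_closed(1)[OF assms(1,2)]
    by (intro fin_add_measure_mono[OF ring_joint_ring fin_add_lam])
  moreover have "(norm (chi A - chi B))\<^sup>2 = lam A + lam B - 2 * lam (A \<inter> B)"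
    unfolding norm_eq_Re_cinner
    by (simp add: cinner_diff_left cinner_diff_right cinner_chi assms(1,2) Int_commute[of B A])
  ultimately show ?thesis by simp
qed

lemma chi_eq_0:
  assumes "A \<in> joint_ring mu" "lam A = 0"
  shows "chi A = 0"
  using norm_eq_Re_cinner[of "chi A"] cinner_chi[of A A] assms by simp

text \<open>Blocks are closed under intersections, so the induction rule for generated rings
  applies, and \<open>chi\<close> respects its two operations.\<close>

lemma chi_block_ring:
  assumes "is_ONB f" "A \<in> block_ring f"
  shows "chi A \<in> cspan (chi ` blocks f)"
proof -
  show ?thesis using assms(2)[unfolded block_ring_def]
  proof (induction rule: generated_ring_of_sets_induct)
    case (Int A B)
    then show ?case by (rule blocks_Int)
  next
    case empty
    show ?case unfolding blocks_def by simp
  next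
    case (basic A)
    then show ?case by (intro subsetD[OF cspan_superset] imageI)
  next
    case (diff A B)
    then show ?case
      using block_ring_joint_ring[OF assms(1)] unfolding block_ring_def
      by (simp add: chi_Diff cspan_diff)
  next
    case (union A B)
    then show ?case
      using block_ring_joint_ring[OF assms(1)] unfolding block_ring_def
      by (simp add: chi_Un cspan_add)
  qed
qed

text \<open>A set of the completion has an inner approximation \<open>B\<close> in the block ring,
  and the squared distance of the vectors is at most the measure of \<open>C - B\<close>. Hence it
  suffices to study blocks.\<close>

lemma closure_cspan_basis_ring:
  assumes f: "is_ONB f"
  shows "closure (cspan (chi ` basis_ring mu f)) = closure (cspan (chi ` blocks f))"
proof
  have "blocks f \<subseteq> basis_ring mu f"
    using generated_ring_of_sets_superset block_ring_subset_basis_ring[OF f]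
    unfolding block_ring_def by blast
  then have "chi ` blocks f \<subseteq> closure (cspan (chi ` basis_ring mu f))"
    using closure_cspan_superset by blast
  then show "closure (cspan (chi ` blocks f)) \<subseteq> closure (cspan (chi ` basis_ring mu f))"
    by (rule closure_cspan_minimal)
  have "chi A \<in> closure (cspan (chi ` blocks f))" if A: "A \<in> basis_ring mu f" for A
    unfolding closure_approachable
  proof (intro allI impI)
    fix \<epsilon> :: real assume "0 < \<epsilon>"
    then have "0 < \<epsilon>\<^sup>2" by simp
    then obtain B C where BC: "B \<in> block_ring f" "C \<in> block_ring f" "B \<subseteq> A" "A \<subseteq> C" "mu f (C - B) < \<epsilon>\<^sup>2"
      using A unfolding basis_ring_def completed_ring_def by blast
    interpret ring_of_sets UNIV "block_ring f" by (rule ring_block_ring)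
    have AJ: "A \<in> joint_ring mu" using A basis_ring_subset_joint_ring[OF f] by blast
    have J: "B \<in> joint_ring mu" "C \<in> joint_ring mu"
      using BC block_ring_joint_ring[OF f] by auto
    have "(norm (chi B - chi A))\<^sup>2 \<le> lam A - lam B"
      using norm_chi_diff_le[OF J(1) AJ J(1)] BC by simp
    also have "\<dots> \<le> lam C - lam B"
      using fin_add_measure_mono[OF ring_joint_ring fin_add_lam AJ J(2)] BC by simp
    also have "\<dots> = lam (C - B)"
      using fin_add_measure_Diff[OF ring_joint_ring fin_add_lam J] BC by auto
    also have "\<dots> < \<epsilon>\<^sup>2" using BC(5) lam_block_ring[OF f Diff[OF BC(2,1)]] by simp
    finally have "norm (chi B - chi A) < \<epsilon>" using \<open>0 < \<epsilon>\<close> by (simp add: power2_less_imp_less)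
    then show "\<exists>y\<in>cspan (chi ` blocks f). dist y (chi A) < \<epsilon>"
      using chi_block_ring[OF f BC(1)] by (auto simp: dist_norm)
  qed
  then show "closure (cspan (chi ` basis_ring mu f)) \<subseteq> closure (cspan (chi ` blocks f))"
    by (intro closure_cspan_minimal) auto
qed

end

section \<open>Rotated blocks\<close>

locale rotation_L2 = rotation_group e a L + joint_L2 mu lam chi
  for e :: "nat \<Rightarrow> 'e::{real_inner, complete_space}" and a L mu lam
    and chi :: "'e set \<Rightarrow> 'h::complex_hilbert_space" +
  assumes summable_a: "summable (\<lambda>k. \<bar>a k\<bar>)"
begin

text \<open>The preimage is a block with the same sides, hence of volume 0, and \<open>chi\<close>
  maps null sets to 0.\<close>

lemma chi_vimage_block_eq_0:
  assumes "block_params e b c" "\<not> summable (\<lambda>j. ln (c j - b j))"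
  shows "chi (L t -` block e b c) = 0"
proof -
  have par: "block_params (rotated t) b c" by (rule block_params_rotated[OF assms(1)])
  have "lam (block (rotated t) b c) = 0"
    unfolding lam_block[OF is_ONB_rotated par] block_volume_def using assms(2) by simp
  then show ?thesis unfolding vimage_block
    by (rule chi_eq_0[OF block_joint_ring[OF is_ONB_rotated par]])
qed

text \<open>The set \<open>I\<close> from \<open>block_ring_between\<close> approximates the
  preimage from inside. Its vector lies in the span, and the squared distance is at most the loss of
  volume.\<close>

lemma chi_vimage_block_in_closure:
  assumes "block_params e b c"
  shows "chi (L t -` block e b c) \<in> closure (cspan (chi ` blocks e))"
proof (cases "summable (\<lambda>j. ln (c j - b j))")
  case False
  then show ?thesis using chi_vimage_block_eq_0[OF assms] closure_cspan_0 by simp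
next
  case True
  have par: "block_params (rotated t) b c" by (rule block_params_rotated[OF assms])
  show ?thesis unfolding vimage_block closure_approachable
  proof (intro allI impI)
    fix \<epsilon> :: real assume \<epsilon>: "0 < \<epsilon>"
    then have \<epsilon>2: "0 < \<epsilon>\<^sup>2 / 2" by simp
    let ?\<phi> = "\<lambda>j. \<bar>t\<bar> * \<bar>a (j div 2)\<bar>"
    have \<phi>: "0 \<le> ?\<phi> j" "summable ?\<phi>" for j
      using summable_mult[OF summable_abs_div2[OF summable_a]] by auto
    obtain I b' c' where I: "I \<in> block_ring e" and W: "block_params (rotated t) b' c'"
      "block (rotated t) b' c' \<subseteq> I" and Q: "I \<subseteq> block (rotated t) b c"
      and vol: "block_volume b c - \<epsilon>\<^sup>2 / 2 \<le> block_volume b' c'"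
      by (rule block_ring_between[OF e is_ONB_rotated partner_less_iff \<phi> inner_rotated_le
            inner_rotated_near inner_rotated_near' par True \<epsilon>2])
    have J: "I \<in> joint_ring mu" "block (rotated t) b c \<in> joint_ring mu"
      "block (rotated t) b' c' \<in> joint_ring mu"
      using block_ring_joint_ring[OF e I] block_joint_ring[OF is_ONB_rotated] par W(1) by auto
    have "(norm (chi I - chi (block (rotated t) b c)))\<^sup>2 \<le> lam (block (rotated t) b c) - lam I"
      using norm_chi_diff_le[OF J(1,2,1)] Q by simp
    also have "\<dots> \<le> lam (block (rotated t) b c) - lam (block (rotated t) b' c')"
      using fin_add_measure_mono[OF ring_joint_ring fin_add_lam J(3,1) W(2)] by simp
    also have "\<dots> \<le> \<epsilon>\<^sup>2 / 2"
      using vol lam_block[OF is_ONB_rotated par] lam_block[OF is_ONB_rotated W(1)] by simp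
    also have "\<dots> < \<epsilon>\<^sup>2" using \<epsilon> by simp
    finally have "norm (chi I - chi (block (rotated t) b c)) < \<epsilon>"
      using \<epsilon> by (simp add: power2_less_imp_less)
    then show "\<exists>y\<in>cspan (chi ` blocks e). dist y (chi (block (rotated t) b c)) < \<epsilon>"
      using chi_block_ring[OF e I] by (auto simp: dist_norm)
  qed
qed

text \<open>A block shrunken by the maximal displacement of the coordinates lies both in the given
  block and in its preimage. The total displacement is proportional to \<open>\<bar>t\<bar>\<close>,
  so the loss of volume becomes small as \<open>t\<close> tends to 0.\<close>

lemma chi_vimage_block_tendsto:
  assumes par: "block_params e b c"
  shows "((\<lambda>t. chi (L t -` block e b c)) \<longlongrightarrow> chi (block e b c)) (at 0)"
proof (cases "summable (\<lambda>j. ln (c j - b j))")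
  case False
  \<comment> \<open>The case of time 0 shows that the limit vector vanishes as well.\<close>
  have "L 0 -` block e b c = block e b c" by (simp add: L_zero vimage_def)
  then show ?thesis
    using chi_vimage_block_eq_0[OF assms False] chi_vimage_block_eq_0[OF assms False, of 0] by simp
next
  case True
  show ?thesis
  proof (rule tendstoI)
    fix \<epsilon> :: real assume \<epsilon>: "0 < \<epsilon>"
    \<comment> \<open>Each of the two blocks loses at most a third, which leaves the final estimate
      strict.\<close>
    then have \<epsilon>3: "0 < \<epsilon>\<^sup>2 / 3" by simp
    obtain \<eta> where \<eta>: "0 < \<eta> \<and> (\<forall>d. (\<forall>j. 0 \<le> d j) \<and> summable d \<and> suminf d < \<eta> \<longrightarrow>
       block_params e (\<lambda>j. b j + d j) (\<lambda>j. c j - d j) \<and>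
       block_volume b c - \<epsilon>\<^sup>2 / 3 \<le> block_volume (\<lambda>j. b j + d j) (\<lambda>j. c j - d j))"
    using block_volume_shrink[OF e par True \<epsilon>3] by (rule exE)
  then have "0 < \<eta>" by blast
    obtain B C where B: "\<And>j. \<bar>b j\<bar> \<le> B" and C: "\<And>j. \<bar>c j\<bar> \<le> C"
      using par bounded_range_abs_bound unfolding block_params_def by metis
    define M where "M = max B C"
    have M: "\<bar>b j\<bar> \<le> M" "\<bar>c j\<bar> \<le> M" "0 \<le> M" for j
      using B[of j] C[of j] unfolding M_def by linarith+
    let ?s = "\<lambda>j. \<bar>a (j div 2)\<bar>"
    have s: "summable ?s" by (rule summable_abs_div2[OF summable_a])
    have "((\<lambda>t. 2 * M * \<bar>t\<bar> * suminf ?s) \<longlongrightarrow> 2 * M * \<bar>0\<bar> * suminf ?s) (at 0)"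
      by (intro tendsto_intros)
    then have "eventually (\<lambda>t. 2 * M * \<bar>t\<bar> * suminf ?s < \<eta>) (at 0)"
      by (rule order_tendstoD) (use \<open>0 < \<eta>\<close> in simp)
    then show "eventually (\<lambda>t. dist (chi (L t -` block e b c)) (chi (block e b c)) < \<epsilon>) (at 0)"
    proof eventually_elim
      case (elim t)
      \<comment> \<open>This is the bound of \<open>inner_rotated_near\<close> for a point whose
        coordinates are at most \<open>M\<close> in absolute value.\<close>
      define d where "d j = 2 * M * \<bar>t\<bar> * ?s j" for j
      have d: "0 \<le> d j" for j using M(3) unfolding d_def by simp
      have sd: "summable d" unfolding d_def using s by (rule summable_mult)
      have "suminf d < \<eta>" using elim suminf_mult[OF s, of "2 * M * \<bar>t\<bar>"] unfolding d_def by simp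
      with d sd \<eta> have shrink: "block_params e (\<lambda>j. b j + d j) (\<lambda>j. c j - d j)"
        "block_volume b c - \<epsilon>\<^sup>2 / 3 \<le> block_volume (\<lambda>j. b j + d j) (\<lambda>j. c j - d j)"
        by simp_all
      let ?W = "block e (\<lambda>j. b j + d j) (\<lambda>j. c j - d j)"
      have parQ: "block_params (rotated t) b c" by (rule block_params_rotated[OF par])
      have sub: "?W \<subseteq> block (rotated t) b c \<inter> block e b c"
      proof
        fix x assume "x \<in> ?W"
        then have x: "b j + d j \<le> x \<bullet> e j" "x \<bullet> e j < c j - d j" for j
          unfolding block_def by auto
        have xM: "\<bar>x \<bullet> e j\<bar> \<le> M" for j
          using x[of j] d[of j] M(1,2)[of j] by linarith
        have near: "\<bar>x \<bullet> rotated t j - x \<bullet> e j\<bar> \<le> d j" for j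
        proof -
          have "\<bar>t\<bar> * ?s j * (\<bar>x \<bullet> e j\<bar> + \<bar>x \<bullet> e (partner j)\<bar>) \<le> \<bar>t\<bar> * ?s j * (M + M)"
            by (intro mult_left_mono add_mono xM) simp
          then show ?thesis using inner_rotated_near[of x t j] unfolding d_def by argo
        qed
        have "b j \<le> x \<bullet> e j \<and> x \<bullet> e j < c j" for j
          using x[of j] d[of j] by linarith
        moreover have "b j \<le> x \<bullet> rotated t j \<and> x \<bullet> rotated t j < c j" for j
          using x[of j] near[of j] by linarith
        ultimately show "x \<in> block (rotated t) b c \<inter> block e b c" unfolding block_def by simp
      qed
      have "(norm (chi (block (rotated t) b c) - chi (block e b c)))\<^sup>2
          \<le> (lam (block (rotated t) b c) - lam ?W) + (lam (block e b c) - lam ?W)"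
        using sub shrink
        by (intro norm_chi_diff_le block_joint_ring is_ONB_rotated e par parQ) auto
      also have "\<dots> \<le> \<epsilon>\<^sup>2 / 3 + \<epsilon>\<^sup>2 / 3"
        using shrink lam_block[OF is_ONB_rotated parQ] lam_block[OF e par] lam_block[OF e, of "\<lambda>j. b j + d j"]
        by (intro add_mono) auto
      also have "\<dots> < \<epsilon>\<^sup>2" using \<epsilon> by simp
      finally show ?case unfolding vimage_block dist_norm
        using \<epsilon> by (simp add: power2_less_imp_less)
    qed
  qed
qed

end

theorem lemma7p2:
  fixes e :: "nat \<Rightarrow> 'e::{real_inner, complete_space}"
    and a :: "nat \<Rightarrow> real"
    and L :: "real \<Rightarrow> 'e \<Rightarrow> 'e"
    and mu :: "(nat \<Rightarrow> 'e) \<Rightarrow> 'e set \<Rightarrow> real"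
    and lam :: "'e set \<Rightarrow> real"
    and chi :: "'e set \<Rightarrow> 'h::complex_hilbert_space"
    and U :: "real \<Rightarrow> 'h \<Rightarrow> 'h"
  defines "R \<equiv> completed_ring (joint_ring mu) lam"
    and "lambda \<equiv> completed_measure (joint_ring mu) lam"
    and "H\<^sub>e \<equiv> closure (cspan (chi ` basis_ring mu e))"
  assumes "is_ONB e"
    and "is_rotation_group e a L"
    and "\<And>f. is_ONB f \<Longrightarrow> is_block_measure f (mu f)"
    and "is_joint_measure mu lam"
    and "is_L2_space R lambda chi"
    and "\<And>t. unitary_on UNIV (U t)"
    and "\<And>t A. A \<in> R \<Longrightarrow> U t (chi A) = chi (L t -` A)"
    and "summable (\<lambda>k. \<bar>a k\<bar>)"
  shows "(\<forall>t. U t ` H\<^sub>e \<subseteq> H\<^sub>e) \<and> strongly_continuous_unitary_group_on H\<^sub>e U"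
proof -
  note unitary = assms(9) and U_chi = assms(10)
  interpret rotation_L2 e a L mu lam chi
    using assms(4-8,11) unfolding R_def lambda_def by unfold_locales
  have R: "L t -` block e b c \<in> R" "block e b c \<in> R" if "block_params e b c" for t b c
    unfolding R_def vimage_block
    by (intro subsetD[OF joint_ring_subset_completed] block_joint_ring e is_ONB_rotated
        block_params_rotated that)+
  have chi_empty: "chi {} = 0"
  proof (rule chi_eq_0)
    interpret ring_of_sets UNIV "joint_ring mu" by (rule ring_joint_ring)
    show "{} \<in> joint_ring mu" by (rule empty_sets)
    show "lam {} = 0" by (rule fin_add_measure_empty[OF ring_joint_ring fin_add_lam])
  qed
  have U_0: "U t 0 = 0" for t
    using unitary[of t] unfolding unitary_on_def by (metis UNIV_I add_cancel_right_right)
  \<comment> \<open>The empty set is a member of \<open>blocks\<close> without parameters; its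
    vector is 0 and is treated separately.\<close>
  have chi_cases: "x = 0 \<or> (\<exists>b c. block_params e b c \<and> x = chi (block e b c))"
    if "x \<in> chi ` blocks e" for x
    using that chi_empty unfolding blocks_def by auto
  \<comment> \<open>The generators are reduced to blocks, whose preimages are explicitly
    known.\<close>
  show ?thesis
    unfolding H\<^sub>e_def closure_cspan_basis_ring[OF e]
  proof (rule strongly_continuous_unitary_group_closure_cspan)
    show "unitary_on UNIV (U t)" for t by (rule unitary)
    fix x assume "x \<in> chi ` blocks e"
    then consider "x = 0" | b c where "block_params e b c" "x = chi (block e b c)"
      using chi_cases by blast
    note x_cases = this
    show "U t x \<in> closure (cspan (chi ` blocks e))" for t
      using x_cases
      by cases (simp_all add: U_0 closure_cspan_0 U_chi R chi_vimage_block_in_closure)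
    show "U 0 x = x"
      using x_cases by cases (simp_all add: U_0 U_chi R L_zero vimage_def)
    show "U (s + t) x = U s (U t x)" for s t
      using x_cases
    proof cases
      case (2 b c)
      \<comment> \<open>Preimages reverse the order of composition, so the group law is used in the
        form \<open>L (t + s) x = L t (L s x)\<close>.\<close>
      have "L (s + t) -` block e b c = L s -` (L t -` block e b c)"
        using L_add[of t s] by (simp add: vimage_def add.commute)
      with 2 show ?thesis by (simp add: U_chi R)
    qed (simp add: U_0)
    show "((\<lambda>t. U t x) \<longlongrightarrow> x) (at 0)"
      using x_cases
      by cases (simp_all add: U_0 U_chi R chi_vimage_block_tendsto)
  qed
qed

end
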